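(* (i) Let $\alpha\in[0,4)$. Then, as $n\to\infty$, $E_n^{\alpha}$ $\Gamma$-converges with respect to the $L^1_{loc}$-topology to the functional $E^\alpha$ defined on $L^1_{loc}(\mathbb{R})$ by $$E^{\alpha}(\theta)=\begin{cases} C_\alpha\,\#(S(\theta)\cap[0,1)) & \text{if }\theta\in PC_{loc}(\mathbb{R}),\ \theta\in\{\pm\theta_\alpha\}\text{ a.e., and }\theta\text{ is 1-periodic},\\ +\infty & \text{otherwise.}\end{cases}$$ (ii) Let $\alpha\in[4,+\infty)$. Then, as $n\to\infty$, $E_n^{\alpha}$ $\Gamma$-converges with respect to the $L^1_{loc}$-topology to the functional $E^\alpha$ defined on $L^1_{loc}(\mathbb{R})$ by $$E^{\alpha}(\theta)=\begin{cases} 0 & \text{if }\theta=0,\\ +\infty & \text{otherwise.}\end{cases}$$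
   Context: Let $I=(0,1)$, $J=[-\pi/2,\pi/2]$, $\lambda_n=1/n$ for $n\in\mathbb{N}$. $\mathcal{D}_n(I)$ is the set of functions $\theta$ obtained as piecewise-constant interpolations of lattice functions $\lambda_n\mathbb{Z}\cap[0,1]\to J$, $i\lambda_n\mapsto\theta^i$, satisfying the periodicity condition $\theta^0=\theta^n$; that is, $\theta(t)=\theta^i$ for $t\in(i\lambda_n,(i+1)\lambda_n)$, $i\in\{0,\dots,n-1\}$. Such functions are regarded as functions on $\mathbb{R}$ by 1-periodic extension. For $\alpha\ge 0$ set $m_\alpha=-(\alpha^2/8+1)$ if $\alpha\in[0,4]$ and $m_\alpha=-\alpha+1$ if $\alpha\ge4$. The energies are $$E_n^\alpha(\theta)=-\frac{\alpha}{2}\sum_{i=0}^{n-1}(\cos\theta^i+\cos\theta^{i+1})+\sum_{i=0}^{n-1}\cos(\theta^i+\theta^{i+1})-nm_\alpha\quad\text{if }\theta\in\mathcal{D}_n(I),$$ and $E_n^\alpha(\theta)=+\infty$ otherwise. For $\alpha\in[0,4]$, $\theta_\alpha=\arccos(\alpha/4)$. For $\alpha\in[0,4)$ the crease transition energy is $$C_\alpha=\inf_{N\in\mathbb{N}}\min\Bigl\{\sum_{i=-\infty}^{+\infty}\Bigl[\cos(\theta^{i}+\theta^{i+1})-\frac{\alpha}{2}(\cos\theta^{i}+\cos\theta^{i+1})-m_\alpha\Bigr]:\ \theta:\mathbb{Z}\to[-\pi/2,\pi/2],\ \theta^i=\mathrm{sign}(i)\theta_\alpha\text{ if }|i|\ge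 N\Bigr\}$$ (all summands are non-negative), with the convention $\mathrm{sign}(0)=-1$. $PC_{loc}(\mathbb{R})$ is the space of locally piecewise constant functions on $\mathbb{R}$ (finitely many jumps in each bounded interval), $S(\theta)$ is the jump set of $\theta$, and $\#$ denotes cardinality. *)

theory Defs
  imports "HOL-Analysis.Analysis"
begin

text \<open>
  Elements of \<open>L\<^sup>1\<^sub>l\<^sub>o\<^sub>c(\<real>)\<close> are represented by locally Lebesgue integrable functions
  \<open>real \<Rightarrow> real\<close>; every notion below depends only on the almost-everywhere class of its
  argument.
\<close>

definition L1_loc :: "(real \<Rightarrow> real) set" where
  "L1_loc = {u. \<forall>a b. set_integrable lebesgue {a..b} u}"

definition tendsto_L1_loc :: "(nat \<Rightarrow> real \<Rightarrow> real) \<Rightarrow> (real \<Rightarrow> real) \<Rightarrow> bool" where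
  "tendsto_L1_loc us u \<longleftrightarrow>
     (\<forall>a b. (\<lambda>k. LINT t:{a..b}|lebesgue. \<bar>us k t - u t\<bar>) \<longlonglongrightarrow> 0)"

text \<open>
  Sequential \<open>\<Gamma>\<close>-convergence on the set \<open>X\<close> for the notion of convergence \<open>conv\<close>. The
  topology of \<open>L\<^sup>1\<^sub>l\<^sub>o\<^sub>c\<close> is metrizable, so there it agrees with the topological notion.
\<close>

definition gamma_converges ::
  "'a set \<Rightarrow> ((nat \<Rightarrow> 'a) \<Rightarrow> 'a \<Rightarrow> bool) \<Rightarrow> (nat \<Rightarrow> 'a \<Rightarrow> ereal) \<Rightarrow> ('a \<Rightarrow> ereal) \<Rightarrow> bool" where
  "gamma_converges X conv F F0 \<longleftrightarrow>
     (\<forall>u\<in>X.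
        (\<forall>us. (\<forall>n. us n \<in> X) \<and> conv us u \<longrightarrow> F0 u \<le> liminf (\<lambda>n. F n (us n))) \<and>
        (\<exists>us. (\<forall>n. us n \<in> X) \<and> conv us u \<and> limsup (\<lambda>n. F n (us n)) \<le> F0 u))"


subsection \<open>Discrete functions\<close>

text \<open>
  The node \<open>i/n\<close> is encoded by its index \<open>i \<in> {0..n}\<close>. Taking extensional functions makes
  the lattice function determined by its interpolation (see \<open>lattice_values_interp\<close>).
\<close>

definition lattice_functions :: "nat \<Rightarrow> (nat \<Rightarrow> real) set" where
  "lattice_functions n = {v \<in> {0..n} \<rightarrow>\<^sub>E {-pi/2..pi/2}. v 0 = v n}"

definition interp :: "nat \<Rightarrow> (nat \<Rightarrow> real) \<Rightarrow> real \<Rightarrow> real" where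
  "interp n v t = v (nat \<lfloor>real n * frac t\<rfloor>)"

definition discrete_functions :: "nat \<Rightarrow> (real \<Rightarrow> real) set" where
  "discrete_functions n = {\<theta>. \<exists>v\<in>lattice_functions n. AE t in lebesgue. \<theta> t = interp n v t}"

definition lattice_values :: "nat \<Rightarrow> (real \<Rightarrow> real) \<Rightarrow> nat \<Rightarrow> real" where
  "lattice_values n \<theta> =
     (THE v. v \<in> lattice_functions n \<and> (AE t in lebesgue. \<theta> t = interp n v t))"

lemma interp_cell:
  assumes "i < n" "real i / real n < t" "t < real (Suc i) / real n"
  shows "interp n v t = v i"
proof -
  have n: "0 < real n" using assms(1) by simp
  have 1: "real i < real n * t" "real n * t < real i + 1"
    using assms n by (auto simp: field_simps)
  have "0 \<le> real i / real n" by simp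
  then have "0 \<le> t" using assms(2) by linarith
  have "real (Suc i) / real n \<le> 1" using assms(1) by (simp add: field_simps)
  then have "t < 1" using assms(3) by linarith
  have "frac t = t" using \<open>0 \<le> t\<close> \<open>t < 1\<close> by (simp add: frac_eq)
  moreover have "\<lfloor>real n * t\<rfloor> = int i" using 1 by (simp add: floor_eq_iff)
  ultimately show ?thesis by (simp add: interp_def)
qed

lemma interp_inject:
  assumes "0 < n" "v \<in> lattice_functions n" "w \<in> lattice_functions n"
    and ae: "AE t in lebesgue. interp n v t = interp n w t"
  shows "v = w"
proof -
  have lt: "v i = w i" if i: "i < n" for i
  proof (rule ccontr)
    assume ne: "v i \<noteq> w i"
    let ?A = "{real i / real n<..<real (Suc i) / real n}"
    have "AE t in lebesgue. t \<notin> ?A"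
      using ae by (rule AE_mp) (use ne interp_cell[OF i] in \<open>auto intro!: AE_I2\<close>)
    then have "emeasure lebesgue ?A = 0"
      by (subst (asm) AE_iff_measurable[of ?A]) auto
    then show False
      using i by (simp add: divide_right_mono field_simps)
  qed
  have "v i = w i" for i
  proof (cases "i \<le> n")
    case True
    then show ?thesis
      using lt[of i] lt[of 0] assms(1-3) unfolding lattice_functions_def
      by (cases "i = n") auto
  next
    case False
    have "v \<in> extensional {0..n}" "w \<in> extensional {0..n}"
      using assms(2,3) by (auto simp: lattice_functions_def PiE_def)
    moreover have "i \<notin> {0..n}" using False by simp
    ultimately show ?thesis by (metis extensional_arb)
  qed
  then show ?thesis by blast
qed

lemma lattice_values_interp:
  assumes "0 < n" "v \<in> lattice_functions n" "AE t in lebesgue. \<theta> t = interp n v t"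
  shows "lattice_values n \<theta> = v"
  unfolding lattice_values_def
proof (rule the_equality)
  fix w assume w: "w \<in> lattice_functions n \<and> (AE t in lebesgue. \<theta> t = interp n w t)"
  then have "AE t in lebesgue. interp n w t = interp n v t"
    using assms(3) by auto
  then show "w = v" using interp_inject assms w by blast
qed (use assms in auto)


subsection \<open>The energies\<close>

definition m_min :: "real \<Rightarrow> real" where
  "m_min \<alpha> = (if \<alpha> \<le> 4 then - (\<alpha>^2 / 8 + 1) else - \<alpha> + 1)"

definition E_n :: "nat \<Rightarrow> real \<Rightarrow> (real \<Rightarrow> real) \<Rightarrow> ereal" where
  "E_n n \<alpha> \<theta> =
     (if \<theta> \<in> discrete_functions n then
        let v = lattice_values n \<theta> in
          ereal (- (\<alpha> / 2) * (\<Sum>i<n. cos (v i) + cos (v (i + 1)))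
                 + (\<Sum>i<n. cos (v i + v (i + 1))) - real n * m_min \<alpha>)
      else \<infinity>)"


subsection \<open>The crease transition energy\<close>

definition crease_angle :: "real \<Rightarrow> real" where
  "crease_angle \<alpha> = arccos (\<alpha> / 4)"

text \<open>Not \<open>sgn\<close>: the convention at \<open>0\<close> is \<open>-1\<close>.\<close>

definition crease_sign :: "int \<Rightarrow> real" where
  "crease_sign i = (if i > 0 then 1 else - 1)"

definition crease_profiles :: "real \<Rightarrow> nat \<Rightarrow> (int \<Rightarrow> real) set" where
  "crease_profiles \<alpha> N =
     {\<theta>. (\<forall>i. \<theta> i \<in> {-pi/2..pi/2}) \<and> (\<forall>i. \<bar>i\<bar> \<ge> int N \<longrightarrow> \<theta> i = crease_sign i * crease_angle \<alpha>)}"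

definition bond_energy :: "real \<Rightarrow> real \<Rightarrow> real \<Rightarrow> real" where
  "bond_energy \<alpha> x y = cos (x + y) - \<alpha> / 2 * (cos x + cos y) - m_min \<alpha>"

definition profile_energy :: "real \<Rightarrow> (int \<Rightarrow> real) \<Rightarrow> real" where
  "profile_energy \<alpha> \<theta> = (\<Sum>\<^sub>\<infinity>i\<in>UNIV. bond_energy \<alpha> (\<theta> i) (\<theta> (i + 1)))"

text \<open>
  The inner infimum is a minimum (\<open>profile_energy_attains_min\<close>), and the sets of energies are
  bounded below by \<open>0\<close> (\<open>profile_energy_nonneg\<close>).
\<close>

definition crease_energy :: "real \<Rightarrow> real" where
  "crease_energy \<alpha> = (INF N\<in>{1..}. INF \<theta>\<in>crease_profiles \<alpha> N. profile_energy \<alpha> \<theta>)"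

lemma bond_energy_nonneg:
  assumes "0 \<le> \<alpha>" "\<alpha> \<le> 4"
  shows "0 \<le> bond_energy \<alpha> x y"
proof -
  define s d where "s = (x + y) / 2" and "d = (x - y) / 2"
  have xy: "x = s + d" "y = s - d" by (auto simp: s_def d_def field_simps)
  have "cos (x + y) = 2 * (cos s)^2 - 1"
    using cos_double_cos[of s] unfolding s_def by (metis mult.commute nonzero_eq_divide_eq zero_neq_numeral)
  moreover have "cos x + cos y = 2 * cos s * cos d"
    unfolding xy by (simp add: cos_add cos_diff)
  ultimately have "bond_energy \<alpha> x y = 2 * (cos s - \<alpha> * cos d / 4)^2 + \<alpha>^2 / 8 * (1 - (cos d)^2)"
    using assms by (simp add: bond_energy_def m_min_def power2_eq_square field_simps)
  moreover have "(cos d)^2 \<le> 1" by (simp add: abs_square_le_1)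
  ultimately show ?thesis by simp
qed

lemma bond_energy_crease_angle:
  assumes "0 \<le> \<alpha>" "\<alpha> \<le> 4" "x = crease_angle \<alpha> \<or> x = - crease_angle \<alpha>"
  shows "bond_energy \<alpha> x x = 0"
proof -
  have "cos x = \<alpha> / 4" using assms by (auto simp: crease_angle_def)
  moreover have "cos (x + x) = 2 * (cos x)^2 - 1" using cos_double_cos[of x] unfolding mult_2[of x] .
  moreover have "m_min \<alpha> = - (\<alpha>^2 / 8 + 1)" using assms by (simp add: m_min_def)
  ultimately have "bond_energy \<alpha> x x = 2 * (\<alpha> / 4)^2 - 1 - \<alpha> / 2 * (\<alpha> / 4 + \<alpha> / 4) + (\<alpha>^2 / 8 + 1)"
    unfolding bond_energy_def by (simp only: diff_minus_eq_add)
  then show ?thesis by (simp add: power2_eq_square)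
qed

lemma profile_energy_nonneg:
  assumes "0 \<le> \<alpha>" "\<alpha> \<le> 4"
  shows "0 \<le> profile_energy \<alpha> \<theta>"
  unfolding profile_energy_def by (intro infsum_nonneg bond_energy_nonneg assms)

lemma profile_energy_eq_sum:
  assumes "0 \<le> \<alpha>" "\<alpha> \<le> 4" "\<theta> \<in> crease_profiles \<alpha> N"
  shows "profile_energy \<alpha> \<theta> = (\<Sum>i\<in>{- int N - 1..int N}. bond_energy \<alpha> (\<theta> i) (\<theta> (i + 1)))"
proof -
  have "bond_energy \<alpha> (\<theta> i) (\<theta> (i + 1)) = 0" if "i \<notin> {- int N - 1..int N}" for i
  proof -
    have "\<theta> i = crease_sign i * crease_angle \<alpha>" "\<theta> (i + 1) = crease_sign (i + 1) * crease_angle \<alpha>"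
      using assms(3) that by (auto simp: crease_profiles_def)
    moreover have "crease_sign (i + 1) = crease_sign i" using that by (auto simp: crease_sign_def)
    ultimately show ?thesis
      using bond_energy_crease_angle[OF assms(1,2), of "\<theta> i"] by (auto simp: crease_sign_def)
  qed
  then have "profile_energy \<alpha> \<theta> =
      infsum (\<lambda>i. bond_energy \<alpha> (\<theta> i) (\<theta> (i + 1))) {- int N - 1..int N}"
    unfolding profile_energy_def by (intro infsum_cong_neutral) auto
  then show ?thesis by simp
qed

lemma profile_energy_attains_min:
  assumes "0 \<le> \<alpha>" "\<alpha> \<le> 4"
  shows "\<exists>\<theta>\<in>crease_profiles \<alpha> N. \<forall>\<phi>\<in>crease_profiles \<alpha> N. profile_energy \<alpha> \<theta> \<le> profile_energy \<alpha> \<phi>"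
proof -
  have angle: "0 \<le> crease_angle \<alpha>" "crease_angle \<alpha> \<le> pi / 2"
    unfolding crease_angle_def
    by (rule arccos_lbound arccos_le_pi2; use assms in linarith)+
  define K where "K i = (if \<bar>i\<bar> \<ge> int N then {crease_sign i * crease_angle \<alpha>} else {-pi/2..pi/2})" for i
  have eq: "crease_profiles \<alpha> N = PiE UNIV K"
  proof -
    have "crease_sign i * crease_angle \<alpha> \<in> {-pi/2..pi/2}" for i
      using angle by (simp add: crease_sign_def)
    then have "K i = {x. x \<in> {-pi/2..pi/2} \<and> (\<bar>i\<bar> \<ge> int N \<longrightarrow> x = crease_sign i * crease_angle \<alpha>)}" for i
      unfolding K_def by (cases "\<bar>i\<bar> \<ge> int N") (simp_all add: set_eq_iff, blast+)
    then have "\<theta> \<in> crease_profiles \<alpha> N \<longleftrightarrow> (\<forall>i. \<theta> i \<in> K i)" for \<theta>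
      unfolding crease_profiles_def by simp blast
    then show ?thesis by (auto simp: PiE_UNIV_domain)
  qed
  have "compactin (product_topology (\<lambda>i. euclidean) UNIV) (PiE UNIV K)"
    by (subst compactin_PiE) (auto simp: K_def)
  then have "compact (crease_profiles \<alpha> N)"
    by (simp add: eq euclidean_product_topology)
  moreover have "crease_profiles \<alpha> N \<noteq> {}"
    unfolding eq by (auto simp: PiE_eq_empty_iff K_def)
  moreover have "continuous_on (crease_profiles \<alpha> N)
      (\<lambda>\<theta>. \<Sum>i\<in>{- int N - 1..int N}. bond_energy \<alpha> (\<theta> i) (\<theta> (i + 1)))"
    unfolding bond_energy_def
    by (intro continuous_on_sum continuous_on_diff continuous_on_mult continuous_on_add
        continuous_on_cos continuous_on_const
        continuous_on_subset[OF continuous_on_product_coordinates] subset_UNIV)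
  ultimately obtain \<theta> where \<theta>: "\<theta> \<in> crease_profiles \<alpha> N"
    "\<forall>\<phi>\<in>crease_profiles \<alpha> N.
      (\<Sum>i\<in>{- int N - 1..int N}. bond_energy \<alpha> (\<theta> i) (\<theta> (i + 1)))
        \<le> (\<Sum>i\<in>{- int N - 1..int N}. bond_energy \<alpha> (\<phi> i) (\<phi> (i + 1)))"
    by (rule continuous_attains_inf[THEN bexE])
  show ?thesis
  proof (rule bexI[OF _ \<theta>(1)], rule ballI)
    fix \<phi> assume "\<phi> \<in> crease_profiles \<alpha> N"
    then show "profile_energy \<alpha> \<theta> \<le> profile_energy \<alpha> \<phi>"
      using \<theta> by (simp only: profile_energy_eq_sum[OF assms])
  qed
qed


subsection \<open>The limit energies\<close>

text \<open>
  \<open>PC_loc\<close> consists of the functions with a representative that is constant on each interval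
  avoiding a locally finite set; almost-everywhere classes have no pointwise values, so
  the jump set is given by the points at which the one-sided essential limits exist and differ.
\<close>

definition PC_loc :: "(real \<Rightarrow> real) set" where
  "PC_loc = {\<theta>. \<exists>g S. (\<forall>a b. finite (S \<inter> {a..b})) \<and>
      (\<forall>a b. {a<..<b} \<inter> S = {} \<longrightarrow> g constant_on {a<..<b}) \<and>
      (AE t in lebesgue. \<theta> t = g t)}"

definition ess_lim_left :: "(real \<Rightarrow> real) \<Rightarrow> real \<Rightarrow> real \<Rightarrow> bool" where
  "ess_lim_left \<theta> t l \<longleftrightarrow>
     (\<forall>\<epsilon>>0. \<exists>\<delta>>0. AE s in lebesgue. s \<in> {t - \<delta><..<t} \<longrightarrow> \<bar>\<theta> s - l\<bar> < \<epsilon>)"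

definition ess_lim_right :: "(real \<Rightarrow> real) \<Rightarrow> real \<Rightarrow> real \<Rightarrow> bool" where
  "ess_lim_right \<theta> t l \<longleftrightarrow>
     (\<forall>\<epsilon>>0. \<exists>\<delta>>0. AE s in lebesgue. s \<in> {t<..<t + \<delta>} \<longrightarrow> \<bar>\<theta> s - l\<bar> < \<epsilon>)"

definition jump_set :: "(real \<Rightarrow> real) \<Rightarrow> real set" where
  "jump_set \<theta> = {t. \<exists>l r. ess_lim_left \<theta> t l \<and> ess_lim_right \<theta> t r \<and> l \<noteq> r}"

definition E_crease :: "real \<Rightarrow> (real \<Rightarrow> real) \<Rightarrow> ereal" where
  "E_crease \<alpha> \<theta> =
     (if \<theta> \<in> PC_loc
         \<and> (AE t in lebesgue. \<theta> t \<in> {crease_angle \<alpha>, - crease_angle \<alpha>})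
         \<and> (AE t in lebesgue. \<theta> (t + 1) = \<theta> t)
      then ereal (crease_energy \<alpha> * real (card (jump_set \<theta> \<inter> {0..<1})))
      else \<infinity>)"

definition E_flat :: "(real \<Rightarrow> real) \<Rightarrow> ereal" where
  "E_flat \<theta> = (if AE t in lebesgue. \<theta> t = 0 then 0 else \<infinity>)"

end

theory Submission
  imports Defs
begin

text \<open>
  The energy of a lattice function is the sum of its bond energies, and these are non-negative.
  For \<open>0 \<le> \<alpha> \<le> 4\<close> the bond energy is exactly
  \<open>(cos x + cos y - \<alpha>/2)\<^sup>2 / 2 + (sin x - sin y)\<^sup>2 / 2\<close>, so on \<open>[-\<pi>/2, \<pi>/2]\<close> it vanishes only
  when both angles sit in the same one of the two wells \<open>\<plusminus>\<theta>\<^sub>\<alpha>\<close>; for \<open>\<alpha> \<ge> 4\<close> it vanishes there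
  only at \<open>(0, 0)\<close>. The energies are not divided by \<open>n\<close>, so a bounded energy leaves room for a bounded
  number of expensive bonds, and all of the compactness comes from counting.

  Lower bound. Along a subsequence the energies stay below a constant \<open>L\<close> and the functions
  converge almost everywhere. Say that the energy concentrates at a point if each interval around
  it eventually contains lattice bonds of total energy at least \<open>c\<close>. Disjoint intervals
  have disjoint sets of bonds, so inside one period at most \<open>L/c\<close> points can be like that
  (\<open>card_concentration_points\<close>). This is used twice. First, a point of convergence at which
  the limit is outside the wells is a point of concentration, so there are only countably many of
  them and the limit lies in the wells almost everywhere. Second, if near \<open>s\<close> the limit
  takes both well values, then the lattice functions make a transition between the wells near \<open>s\<close>.
  Continuing this piece of the chain by the two constants gives a competitor
  for \<open>C\<^sub>\<alpha>\<close> at a vanishing extra cost (\<open>crease_energy_le_chain\<close>), so the energy concentrates at \<open>s\<close>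
  with every constant below \<open>C\<^sub>\<alpha>\<close>. As \<open>C\<^sub>\<alpha> > 0\<close>, such points are locally finite, which makes the limit
  piecewise constant, and letting \<open>c\<close> tend to \<open>C\<^sub>\<alpha>\<close> bounds the number of jumps in a period.

  Upper bound. Let \<open>N\<close> be the integer part of \<open>sqrt n\<close> and let \<open>\<phi>\<close> be an optimal profile among those
  that sit in the wells outside \<open>(-N, N)\<close>. Sampling the limit at the lattice points and replacing it near each
  jump by \<open>\<phi>\<close> or \<open>-\<phi>\<close>, centred at the jump, gives lattice functions
  whose energy is at most the energy of \<open>\<phi>\<close> for each jump (\<open>recovery_lattice_function\<close>).
  The energy of \<open>\<phi>\<close> tends to \<open>C\<^sub>\<alpha>\<close> because \<open>N\<close> tends to infinity, and the functions converge because \<open>N/n\<close>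
  tends to \<open>0\<close>.

  The count of transitions and the profiles concern \<open>\<alpha> < 4\<close>. For \<open>\<alpha> \<ge> 4\<close> the two wells have merged into
  \<open>0\<close>: the first use of concentration already forces the limit to vanish, and the zero
  function has zero energy for each \<open>n > 0\<close>.
\<close>

section \<open>The bond energy\<close>

lemma bond_energy_eq_squares:
  assumes "\<alpha> \<le> 4"
  shows "bond_energy \<alpha> x y = (cos x + cos y - \<alpha> / 2)^2 / 2 + (sin x - sin y)^2 / 2"
proof -
  have sx: "(sin x)^2 = 1 - (cos x)^2" and sy: "(sin y)^2 = 1 - (cos y)^2"
    by (simp_all add: sin_squared_eq)
  have "(cos x + cos y - \<alpha> / 2)^2 / 2 + (sin x - sin y)^2 / 2
      = ((cos x)^2 + (cos y)^2 + (sin x)^2 + (sin y)^2) / 2 + cos x * cos y - sin x * sin y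
        - \<alpha> / 2 * (cos x + cos y) + \<alpha>^2 / 8"
    by (simp add: power2_eq_square field_simps)
  then show ?thesis using assms sx sy by (simp add: bond_energy_def m_min_def cos_add)
qed

text \<open>
  With \<open>\<alpha> \<ge> 4\<close> the last factor is at least \<open>2 - cos x - cos y\<close>, so both summands are non-negative and
  the second one controls the distance of the angles from \<open>0\<close>.
\<close>

lemma bond_energy_steep_eq:
  assumes "4 \<le> \<alpha>"
  shows "bond_energy \<alpha> x y
    = (sin x - sin y)^2 / 2 + (2 - cos x - cos y) * (\<alpha> - 2 - cos x - cos y) / 2"
proof -
  have m: "m_min \<alpha> = 1 - \<alpha>" using assms by (cases "\<alpha> = 4") (auto simp: m_min_def)
  have sx: "(sin x)^2 = 1 - (cos x)^2" and sy: "(sin y)^2 = 1 - (cos y)^2"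
    by (simp_all add: sin_squared_eq)
  have "(sin x - sin y)^2 / 2 + (2 - cos x - cos y) * (\<alpha> - 2 - cos x - cos y) / 2
      = ((cos x)^2 + (cos y)^2 + (sin x)^2 + (sin y)^2) / 2 + cos x * cos y - sin x * sin y
        - \<alpha> / 2 * (cos x + cos y) + \<alpha> - 2"
    by (simp add: power2_eq_square field_simps)
  then show ?thesis using sx sy m by (simp add: bond_energy_def cos_add)
qed

lemma bond_energy_uminus: "bond_energy \<alpha> (- x) (- y) = bond_energy \<alpha> x y"
  by (simp add: bond_energy_def cos_add cos_diff)

lemma tendsto_bond_energy [tendsto_intros]:
  "(f \<longlongrightarrow> a) F \<Longrightarrow> (g \<longlongrightarrow> b) F \<Longrightarrow> ((\<lambda>t. bond_energy \<alpha> (f t) (g t)) \<longlongrightarrow> bond_energy \<alpha> a b) F"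
  unfolding bond_energy_def by (intro tendsto_intros isCont_tendsto_compose[OF isCont_cos])

text \<open>
  A bound that involves one angle only, which is what pointwise limits need. The first square of the
  bond energy controls \<open>cos x + cos y\<close>, and \<open>cos x - cos y\<close> is controlled by the second one
  since \<open>\<bar>cos x - cos y\<bar>\<^sup>2 \<le> \<bar>cos\<^sup>2 x - cos\<^sup>2 y\<bar> = \<bar>sin\<^sup>2 x - sin\<^sup>2 y\<bar>\<close> for non-negative cosines. Passing from
  sines to cosines loses a square root, hence the fourth power.
\<close>

lemma well_defect_le_bond_energy:
  assumes "0 \<le> \<alpha>" "\<alpha> \<le> 4" "x \<in> {-pi/2..pi/2}" "y \<in> {-pi/2..pi/2}"
  shows "(cos x - \<alpha> / 4)^4 / 4 \<le> bond_energy \<alpha> x y"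
proof -
  define p q where "p = cos x + cos y - \<alpha> / 2" and "q = sin x - sin y"
  have cx: "0 \<le> cos x" and cy: "0 \<le> cos y" using assms(3,4) by (auto intro!: cos_ge_zero)
  have "cos x \<le> 1" "cos y \<le> 1" by auto
  then have "\<bar>p\<bar> \<le> 2" using cx cy assms(1,2) unfolding p_def abs_le_iff by linarith
  then have "p^2 \<le> 2^2" using abs_le_square_iff[of p 2] by simp
  then have p4: "p^4 \<le> 4 * p^2"
    using mult_right_mono[of "p^2" 4 "p^2"] by (simp add: power2_eq_square power4_eq_xxxx mult.assoc)
  have "\<bar>cos x - cos y\<bar> * \<bar>cos x - cos y\<bar> \<le> \<bar>cos x - cos y\<bar> * (cos x + cos y)"
    using cx cy by (intro mult_left_mono) auto
  also have "\<dots> = \<bar>(cos x - cos y) * (cos x + cos y)\<bar>" using cx cy by (simp add: abs_mult)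
  also have "(cos x - cos y) * (cos x + cos y) = (sin y)^2 - (sin x)^2"
    using sin_squared_eq[of x] sin_squared_eq[of y] by (simp add: power2_eq_square algebra_simps)
  also have "\<dots> = - (q * (sin x + sin y))" by (simp add: q_def power2_eq_square algebra_simps)
  also have "\<bar>- (q * (sin x + sin y))\<bar> \<le> \<bar>q\<bar> * 2"
  proof -
    have "\<bar>sin x + sin y\<bar> \<le> 2" using abs_sin_le_one[of x] abs_sin_le_one[of y] by linarith
    then show ?thesis by (simp add: abs_mult mult_left_mono)
  qed
  finally have "(cos x - cos y)^2 \<le> 2 * \<bar>q\<bar>" by (simp add: power2_eq_square)
  then have c4: "((cos x - cos y)^2)^2 \<le> 4 * q^2"
    using power_mono[of "(cos x - cos y)^2" "2 * \<bar>q\<bar>" 2] by (simp add: power_mult_distrib)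
  have avg: "(a + b)^2 \<le> 2 * a^2 + 2 * b^2" for a b :: real
    using zero_le_power2[of "a - b"] unfolding power2_diff power2_sum by linarith
  have e: "2 * (cos x - \<alpha> / 4) = p + (cos x - cos y)" by (simp add: p_def)
  have "16 * (cos x - \<alpha> / 4)^4 = ((2 * (cos x - \<alpha> / 4))^2)^2"
    by (simp only: power_mult_distrib) simp
  also have "\<dots> \<le> (2 * p^2 + 2 * (cos x - cos y)^2)^2"
    unfolding e using avg by (intro power_mono) auto
  also have "\<dots> \<le> 2 * (2 * p^2)^2 + 2 * (2 * (cos x - cos y)^2)^2" by (rule avg)
  also have "\<dots> = 8 * p^4 + 8 * ((cos x - cos y)^2)^2"
    by (simp add: power_mult_distrib flip: power_mult)
  also have "\<dots> \<le> 64 * (p^2 / 2 + q^2 / 2)" using p4 c4 by (simp)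
  finally show ?thesis
    using bond_energy_eq_squares[OF assms(2), of x y] unfolding p_def q_def by simp
qed

lemma flat_defect_le_bond_energy:
  assumes "4 \<le> \<alpha>"
  shows "(cos x - 1)^2 / 2 \<le> bond_energy \<alpha> x y"
proof -
  define a where "a = 1 - cos x"
  define b where "b = 1 - cos y"
  have ab: "0 \<le> a" "0 \<le> b" by (auto simp: a_def b_def)
  have "a * a \<le> (a + b) * (a + b)" using ab by (intro mult_mono) auto
  also have "\<dots> \<le> (a + b) * (\<alpha> - 2 - cos x - cos y)"
  proof (intro mult_left_mono)
    show "a + b \<le> \<alpha> - 2 - cos x - cos y" using assms by (simp add: a_def b_def)
  qed (use ab in simp)
  also have "a + b = 2 - cos x - cos y" by (simp add: a_def b_def)
  finally have "a * a \<le> (2 - cos x - cos y) * (\<alpha> - 2 - cos x - cos y)" .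
  moreover have "(cos x - 1)^2 = a * a" by (simp add: a_def power2_eq_square algebra_simps)
  ultimately show ?thesis
    unfolding bond_energy_steep_eq[OF assms] using zero_le_power2[of "sin x - sin y"] by linarith
qed

lemma bond_energy_nonneg_all_regimes:
  assumes "0 \<le> \<alpha>"
  shows "0 \<le> bond_energy \<alpha> x y"
proof (cases "\<alpha> \<le> 4")
  case False
  then show ?thesis using flat_defect_le_bond_energy[of \<alpha> x y] zero_le_power2[of "cos x - 1"] by linarith
qed (use assms in \<open>simp add: bond_energy_nonneg\<close>)

lemma crease_angle_range:
  assumes "0 \<le> \<alpha>" "\<alpha> < 4"
  shows "0 < crease_angle \<alpha>" "crease_angle \<alpha> \<le> pi / 2"
proof -
  have "arccos 1 < arccos (\<alpha> / 4)" by (rule arccos_less_arccos) (use assms in auto)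
  then show "0 < crease_angle \<alpha>" by (simp add: crease_angle_def)
  show "crease_angle \<alpha> \<le> pi / 2" unfolding crease_angle_def
    by (rule arccos_le_pi2) (use assms in auto)
qed

lemma cos_eq_crease_angle:
  assumes "0 \<le> \<alpha>" "\<alpha> < 4" "x \<in> {-pi/2..pi/2}" "cos x = \<alpha> / 4"
  shows "x \<in> {crease_angle \<alpha>, - crease_angle \<alpha>}"
proof -
  have "arccos (cos \<bar>x\<bar>) = \<bar>x\<bar>"
    by (rule arccos_cos) (use assms(3) pi_gt_zero in \<open>auto simp: abs_le_iff\<close>)
  then have "\<bar>x\<bar> = crease_angle \<alpha>" using assms(4) by (simp add: crease_angle_def)
  then show ?thesis by (auto simp: abs_if split: if_splits)
qed

section \<open>Energies of chains\<close>

text \<open>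
  Lattice functions are handled as sequences indexed by all integers, so that pieces of a chain
  can be cut out and translated without regard to the ends of the period.
\<close>

definition chain_energy :: "real \<Rightarrow> (int \<Rightarrow> real) \<Rightarrow> int \<Rightarrow> int \<Rightarrow> real" where
  "chain_energy \<alpha> w a b = (\<Sum>i\<in>{a..<b}. bond_energy \<alpha> (w i) (w (i + 1)))"

lemma chain_energy_nonneg: "0 \<le> \<alpha> \<Longrightarrow> 0 \<le> chain_energy \<alpha> w a b"
  unfolding chain_energy_def by (intro sum_nonneg bond_energy_nonneg_all_regimes)

lemma chain_energy_mono:
  assumes "0 \<le> \<alpha>" "a' \<le> a" "b \<le> b'"
  shows "chain_energy \<alpha> w a b \<le> chain_energy \<alpha> w a' b'"
  unfolding chain_energy_def by (rule sum_mono2) (use assms bond_energy_nonneg_all_regimes in auto)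

lemma chain_energy_uminus: "chain_energy \<alpha> (\<lambda>i. - w i) a b = chain_energy \<alpha> w a b"
  by (simp add: chain_energy_def bond_energy_uminus)

lemma chain_energy_period:
  assumes per: "\<And>i. w (i + int n) = w i"
  shows "chain_energy \<alpha> w a (a + int n) = chain_energy \<alpha> w 0 (int n)"
proof -
  define f where "f i = bond_energy \<alpha> (w i) (w (i + 1))" for i
  have f: "f (i + int n) = f i" for i
    using per[of i] per[of "i + 1"] by (simp add: f_def algebra_simps)
  have step: "sum f {b+1..<b+1+int n} = sum f {b..<b+int n}" for b
  proof (cases "n = 0")
    case False
    have "sum f {b..<b+1+int n} = f b + sum f {b+1..<b+1+int n}"
    proof -
      have "{b..<b+1+int n} = insert b {b+1..<b+1+int n}" by auto
      then show ?thesis by simp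
    qed
    moreover have "sum f {b..<b+1+int n} = f (b + int n) + sum f {b..<b+int n}"
    proof -
      have "{b..<b+1+int n} = insert (b + int n) {b..<b+int n}" by auto
      then show ?thesis by simp
    qed
    ultimately show ?thesis using f[of b] by simp
  qed simp
  have "sum f {a..<a+int n} = sum f {0..<0+int n}"
  proof (induction a rule: int_induct[where k=0])
    case (step1 i)
    then show ?case using step[of i] by simp
  next
    case (step2 i)
    then show ?case using step[of "i - 1"] by simp
  qed simp
  then show ?thesis by (simp add: chain_energy_def f_def)
qed

lemma crease_energy_le_profile:
  assumes "0 \<le> \<alpha>" "\<alpha> \<le> 4" "1 \<le> N" "\<theta> \<in> crease_profiles \<alpha> N"
  shows "crease_energy \<alpha> \<le> profile_energy \<alpha> \<theta>"
proof -
  have nonneg: "\<And>\<phi>. 0 \<le> profile_energy \<alpha> \<phi>" using profile_energy_nonneg assms by blast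
  have ne: "crease_profiles \<alpha> M \<noteq> {}" for M
    using profile_energy_attains_min[OF assms(1,2), of M] by blast
  have "crease_energy \<alpha> \<le> (INF \<theta>\<in>crease_profiles \<alpha> N. profile_energy \<alpha> \<theta>)"
    unfolding crease_energy_def
  proof (rule cINF_lower)
    show "bdd_below ((\<lambda>N. INF \<theta>\<in>crease_profiles \<alpha> N. profile_energy \<alpha> \<theta>) ` {1..})"
      by (intro bdd_belowI[of _ 0]) (auto intro!: cINF_greatest ne nonneg)
  qed (use assms in simp)
  also have "\<dots> \<le> profile_energy \<alpha> \<theta>"
    by (rule cINF_lower) (use assms nonneg in \<open>auto intro!: bdd_belowI[of _ 0]\<close>)
  finally show ?thesis .
qed

text \<open>
  Any chain can be continued by \<open>-\<theta>\<^sub>\<alpha>\<close> on its left and by \<open>\<theta>\<^sub>\<alpha>\<close> on its right, which yields a crease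
  profile; only the two bonds that join the pieces cost extra energy.
\<close>

lemma crease_energy_le_chain:
  assumes \<alpha>: "0 \<le> \<alpha>" "\<alpha> < 4" and ab: "a \<le> b" and w: "\<And>i. w i \<in> {-pi/2..pi/2}"
  shows "crease_energy \<alpha> \<le> bond_energy \<alpha> (- crease_angle \<alpha>) (w a) + chain_energy \<alpha> w a b
           + bond_energy \<alpha> (w b) (crease_angle \<alpha>)"
proof -
  define d where "d = nat (b - a)"
  have d: "b = a + int d" using ab by (simp add: d_def)
  \<comment> \<open>Translated so that the chain starts at index 0: the crease sign is negative for all indices below it.\<close>
  define \<phi> where "\<phi> i = (if i < 0 then - crease_angle \<alpha> else if i \<le> int d then w (a + i) else crease_angle \<alpha>)"
    for i
  have ang: "0 < crease_angle \<alpha>" "crease_angle \<alpha> \<le> pi / 2" by (rule crease_angle_range[OF \<alpha>])+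
  have \<phi>: "\<phi> \<in> crease_profiles \<alpha> (Suc d)"
    using w ang unfolding crease_profiles_def by (auto simp: \<phi>_def crease_sign_def)
  have \<alpha>': "\<alpha> \<le> 4" using \<alpha> by simp
  let ?f = "\<lambda>i. bond_energy \<alpha> (\<phi> i) (\<phi> (i + 1))"
  have "profile_energy \<alpha> \<phi> = sum ?f {- int (Suc d) - 1..int (Suc d)}"
    by (rule profile_energy_eq_sum[OF \<alpha>(1) \<alpha>' \<phi>])
  also have "\<dots> = sum ?f {-1..int d}"
    by (rule sum.mono_neutral_right) (auto simp: \<phi>_def bond_energy_crease_angle \<alpha>(1) \<alpha>')
  also have "{-1..int d} = insert (-1) (insert (int d) {0..<int d})" by auto
  also have "sum ?f \<dots> = ?f (-1) + (?f (int d) + sum ?f {0..<int d})" by simp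
  also have "?f (-1) = bond_energy \<alpha> (- crease_angle \<alpha>) (w a)" by (simp add: \<phi>_def)
  also have "?f (int d) = bond_energy \<alpha> (w b) (crease_angle \<alpha>)" by (simp add: \<phi>_def d)
  also have "sum ?f {0..<int d} = sum (\<lambda>i. bond_energy \<alpha> (w (a + i)) (w (a + i + 1))) {0..<int d}"
    by (rule sum.cong) (auto simp: \<phi>_def algebra_simps)
  also have "\<dots> = chain_energy \<alpha> w a b"
    unfolding chain_energy_def
    by (rule sum.reindex_bij_witness[where i="\<lambda>i. i - a" and j="\<lambda>i. a + i"]) (auto simp: d)
  finally show ?thesis using crease_energy_le_profile[OF \<alpha>(1) \<alpha>' _ \<phi>] by simp
qed

text \<open>
  A profile changes sign somewhere. Across that bond the sine jumps from the negative to the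
  non-negative side. If the bond were cheap, the jump would be small, so the left angle would be near \<open>0\<close> and
  its cosine near \<open>1\<close>; but a cheap bond also keeps the cosine near \<open>\<alpha>/4 < 1\<close>.
\<close>

lemma crease_energy_pos:
  assumes \<alpha>: "0 \<le> \<alpha>" "\<alpha> < 4"
  shows "0 < crease_energy \<alpha>"
proof -
  define d where "d = 1 - \<alpha> / 4"
  have d: "0 < d" "d \<le> 1" using \<alpha> by (auto simp: d_def)
  \<comment> \<open>Small enough that a bond cheaper than c has a left angle with cosine below 1 - d/2 and squared sine below d/2.\<close>
  define c where "c = d^4 / 64"
  have ang: "0 < crease_angle \<alpha>" "crease_angle \<alpha> \<le> pi / 2" by (rule crease_angle_range[OF \<alpha>])+
  have \<alpha>': "\<alpha> \<le> 4" using \<alpha> by simp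
  have bnd: "c \<le> bond_energy \<alpha> x y" if "x \<in> {-pi/2..pi/2}" "y \<in> {-pi/2..pi/2}" "x < 0" "0 \<le> y" for x y
  proof (rule ccontr)
    assume "\<not> ?thesis"
    then have lt: "bond_energy \<alpha> x y < c" by simp
    have c1: "c \<le> d / 64"
    proof -
      have "d^4 \<le> d^1" using d by (intro power_decreasing) auto
      then show ?thesis by (simp add: c_def)
    qed
    have sx: "sin x \<le> 0" using that(1,3) sin_ge_zero[of "-x"] by simp
    have sy: "0 \<le> sin y" using that(2,4) by (intro sin_ge_zero) auto
    have "(cos x - \<alpha> / 4)^4 / 4 < c"
      using well_defect_le_bond_energy[OF \<alpha>(1) \<alpha>' that(1,2)] lt by linarith
    then have "(cos x - \<alpha> / 4)^4 < (d/2)^4" by (simp add: c_def power_divide)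
    then have "cos x - \<alpha> / 4 < d / 2"
      using power_less_imp_less_base[of "cos x - \<alpha>/4" 4 "d/2"] d by simp
    then have cx: "cos x < 1 - d / 2" by (simp add: d_def field_simps)
    have "(sin x)^2 \<le> (sin x - sin y)^2"
      using sx sy by (intro abs_le_square_iff[THEN iffD1]) auto
    also have "\<dots> \<le> 2 * bond_energy \<alpha> x y"
      using bond_energy_eq_squares[OF \<alpha>', of x y] by simp
    also have "\<dots> < d / 2" using lt c1 d by simp
    finally have "(cos x)^2 > 1 - d / 2" using sin_squared_eq[of x] by simp
    moreover have "(cos x)^2 \<le> cos x"
      using mult_left_mono[of "cos x" 1 "cos x"] cos_ge_zero[of x] that(1) by (simp add: power2_eq_square)
    ultimately show False using cx by simp
  qed
  have prof: "c \<le> profile_energy \<alpha> \<theta>" if "\<theta> \<in> crease_profiles \<alpha> N" "1 \<le> N" for \<theta> N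
  proof -
    have r: "\<theta> i \<in> {-pi/2..pi/2}" for i using that by (auto simp: crease_profiles_def)
    have neg: "\<theta> (- int N) < 0" and pos: "0 \<le> \<theta> (int N)"
      using that ang by (auto simp: crease_profiles_def crease_sign_def)
    have "\<exists>i\<in>{- int N - 1..int N}. \<theta> i < 0 \<and> 0 \<le> \<theta> (i + 1)"
    proof (rule ccontr)
      assume no: "\<not> ?thesis"
      have "- int N \<le> i \<Longrightarrow> i \<le> int N \<longrightarrow> \<theta> i < 0" for i
      proof (induction i rule: int_ge_induct)
        case (step i)
        show ?case
        proof
          assume "i + 1 \<le> int N"
          then have "\<theta> i < 0" "i \<in> {- int N - 1..int N}" using step by auto
          then show "\<theta> (i + 1) < 0" using no by (meson linorder_not_less)
        qed
      qed (use neg in simp)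
      from this[of "int N"] show False using pos by simp
    qed
    then obtain i where i: "i \<in> {- int N - 1..int N}" "\<theta> i < 0" "0 \<le> \<theta> (i + 1)" by blast
    have "c \<le> bond_energy \<alpha> (\<theta> i) (\<theta> (i + 1))" using bnd r i by blast
    also have "\<dots> \<le> (\<Sum>i\<in>{- int N - 1..int N}. bond_energy \<alpha> (\<theta> i) (\<theta> (i + 1)))"
      by (rule member_le_sum) (use i \<alpha> bond_energy_nonneg_all_regimes in auto)
    also have "\<dots> = profile_energy \<alpha> \<theta>"
      using profile_energy_eq_sum[OF \<alpha>(1) \<alpha>' that(1)] by simp
    finally show ?thesis .
  qed
  have "c \<le> crease_energy \<alpha>" unfolding crease_energy_def
  proof (intro cINF_greatest)
    show "crease_profiles \<alpha> N \<noteq> {}" for N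
      using profile_energy_attains_min[OF \<alpha>(1) \<alpha>', of N] by blast
  qed (use prof in auto)
  moreover have "0 < c" using d by (simp add: c_def)
  ultimately show ?thesis by simp
qed

section \<open>Lattice functions as periodic sequences\<close>

definition periodize :: "nat \<Rightarrow> (nat \<Rightarrow> real) \<Rightarrow> int \<Rightarrow> real" where
  "periodize n v i = v (nat (i mod int n))"

lemma periodize_add: "periodize n v (i + int n) = periodize n v i"
  by (simp add: periodize_def)

lemma periodize_range:
  assumes "v \<in> lattice_functions n" "0 < n"
  shows "periodize n v i \<in> {-pi/2..pi/2}"
proof -
  have "i mod int n < int n" using assms(2) by simp
  then have "nat (i mod int n) \<in> {0..n}" by (simp add: nat_le_iff)
  then show ?thesis
    using assms(1) by (auto simp: lattice_functions_def periodize_def PiE_iff)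
qed

lemma interp_eq_periodize:
  assumes "0 < n"
  shows "interp n v t = periodize n v \<lfloor>real n * t\<rfloor>"
proof -
  have fr: "0 \<le> real n * frac t" "real n * frac t < real n"
    using assms frac_lt_1[of t] by auto
  have "real n * t = real n * frac t + real_of_int (int n * \<lfloor>t\<rfloor>)"
    by (simp add: frac_def algebra_simps)
  then have "\<lfloor>real n * t\<rfloor> = \<lfloor>real n * frac t\<rfloor> + int n * \<lfloor>t\<rfloor>"
    by (simp only: floor_add_int)
  moreover have "0 \<le> \<lfloor>real n * frac t\<rfloor>" "\<lfloor>real n * frac t\<rfloor> < int n"
    using fr by (auto simp: floor_less_iff)
  ultimately have "\<lfloor>real n * t\<rfloor> mod int n = \<lfloor>real n * frac t\<rfloor>" by simp
  then show ?thesis by (simp add: interp_def periodize_def)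
qed

lemma E_n_eq_chain_energy:
  assumes n: "0 < n" and v: "v \<in> lattice_functions n"
    and ae: "AE t in lebesgue. \<theta> t = interp n v t"
  shows "E_n n \<alpha> \<theta> = ereal (chain_energy \<alpha> (periodize n v) 0 (int n))"
proof -
  have disc: "\<theta> \<in> discrete_functions n" using v ae by (auto simp: discrete_functions_def)
  have per: "periodize n v (int i) = v i" if "i \<le> n" for i
  proof (cases "i = n")
    case True
    then show ?thesis using v by (simp add: periodize_def lattice_functions_def)
  qed (use that in \<open>simp add: periodize_def flip: of_nat_mod\<close>)
  have "chain_energy \<alpha> (periodize n v) 0 (int n)
      = (\<Sum>i<n. bond_energy \<alpha> (periodize n v (int i)) (periodize n v (int i + 1)))"
    unfolding chain_energy_def
    by (rule sum.reindex_bij_witness[where i=int and j=nat]) auto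
  also have "\<dots> = (\<Sum>i<n. bond_energy \<alpha> (v i) (v (i + 1)))"
  proof (rule sum.cong)
    fix i assume "i \<in> {..<n}"
    then show "bond_energy \<alpha> (periodize n v (int i)) (periodize n v (int i + 1))
        = bond_energy \<alpha> (v i) (v (i + 1))"
      using per[of i] per[of "i + 1"] by (simp add: add.commute)
  qed simp
  also have "\<dots> = - (\<alpha> / 2) * (\<Sum>i<n. cos (v i) + cos (v (i + 1)))
                 + (\<Sum>i<n. cos (v i + v (i + 1))) - real n * m_min \<alpha>"
    by (simp add: bond_energy_def sum.distrib sum_subtractf distrib_left sum_distrib_left sum_negf)
  finally show ?thesis
    using disc lattice_values_interp[OF n v ae] by (simp add: E_n_def Let_def)
qed

lemma E_n_finite_obtain:
  assumes "E_n n \<alpha> \<theta> < \<infinity>" "0 < n"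
  obtains v where "v \<in> lattice_functions n" "AE t in lebesgue. \<theta> t = periodize n v \<lfloor>real n * t\<rfloor>"
    "E_n n \<alpha> \<theta> = ereal (chain_energy \<alpha> (periodize n v) 0 (int n))"
proof -
  have "\<theta> \<in> discrete_functions n" using assms(1) by (auto simp: E_n_def split: if_splits)
  then obtain v where "v \<in> lattice_functions n" "AE t in lebesgue. \<theta> t = interp n v t"
    by (auto simp: discrete_functions_def)
  then show ?thesis using that E_n_eq_chain_energy assms(2) interp_eq_periodize by simp
qed

section \<open>Null sets and locally finite sets of reals\<close>

lemma AE_lebesgue_ex:
  fixes a b :: real
  assumes "AE x in lebesgue. P x" "a < b"
  shows "\<exists>x\<in>{a<..<b}. P x"
proof (rule ccontr)
  assume no: "\<not> ?thesis"
  have "AE x in lebesgue. x \<notin> {a<..<b}"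
    using assms(1) by (rule AE_mp) (use no in \<open>auto intro!: AE_I2\<close>)
  then have "emeasure lebesgue {a<..<b} = 0"
    by (subst (asm) AE_iff_measurable[of "{a<..<b}"]) auto
  then show False using assms(2) by simp
qed

lemma AE_lebesgue_shift:
  fixes c :: real
  assumes "AE x in lebesgue. P x"
  shows "AE x in lebesgue. P (x + c)"
proof -
  from assms have "negligible {x. \<not> P x}"
    by (simp add: negligible_iff_null_sets completion.AE_iff_null_sets)
  then have "negligible ((+) (- c) ` {x. \<not> P x})" by (rule negligible_translation)
  moreover have "(+) (- c) ` {x. \<not> P x} = {x. \<not> P (x + c)}"
    by (auto intro!: image_eqI[where x="_ + c"])
  ultimately show ?thesis
    by (simp add: negligible_iff_null_sets completion.AE_iff_null_sets)
qed

lemma AE_lebesgue_not_in_countable: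
  fixes A :: "real set"
  assumes "countable A"
  shows "AE x in lebesgue. x \<notin> A"
  by (rule AE_not_in) (intro null_sets_completionI countable_imp_null_set_lborel assms)

lemma countable_locally_finite:
  fixes S :: "real set"
  assumes "\<And>a b. finite (S \<inter> {a..b})"
  shows "countable S"
proof -
  have "S = (\<Union>n. S \<inter> {- real n..real n})"
  proof (intro equalityI subsetI)
    fix x assume "x \<in> S"
    obtain n where "\<bar>x\<bar> \<le> real n" using real_arch_simple by blast
    then have "x \<in> {- real n..real n}" by (simp add: abs_le_iff)
    then show "x \<in> (\<Union>n. S \<inter> {- real n..real n})" using \<open>x \<in> S\<close> by blast
  qed blast
  moreover have "countable (\<Union>n. S \<inter> {- real n..real n})"
    by (intro countable_UN countable_finite[OF assms]) auto
  ultimately show ?thesis by simp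
qed

lemma finite_separation:
  fixes Q :: "real set"
  assumes "finite Q"
  obtains d where "0 < d" "\<And>x y. x \<in> Q \<Longrightarrow> y \<in> Q \<Longrightarrow> x < y \<Longrightarrow> x + d \<le> y"
proof -
  have "uniform_discrete Q" using assms uniform_discrete_finite_iff by blast
  then obtain e where e: "e > 0" "\<forall>x\<in>Q. \<forall>y\<in>Q. dist x y < e \<longrightarrow> x = y"
    by (auto simp: uniform_discrete_def)
  show ?thesis
  proof (rule that[OF e(1)])
    fix x y assume "x \<in> Q" "y \<in> Q" "x < y"
    then show "x + e \<le> y" using e(2)[rule_format, of x y] by (force simp: dist_real_def abs_if)
  qed
qed

section \<open>Localisation of the energy\<close>

text \<open>
  Intervals of a common small radius around the points of \<open>P\<close> are disjoint even modulo 1, so the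
  corresponding index windows are disjoint subsets of a single period, whatever period is chosen. Taking \<open>P\<close> in
  \<open>{a..<a+1}\<close> allows a jump at an end of the unit interval.
\<close>

lemma card_concentration_points:
  fixes w :: "nat \<Rightarrow> int \<Rightarrow> real" and m :: "nat \<Rightarrow> nat"
  assumes \<alpha>: "0 \<le> \<alpha>"
    and per: "\<And>k i. w k (i + int (m k)) = w k i"
    and L: "\<And>k. chain_energy \<alpha> (w k) 0 (int (m k)) \<le> L"
    and P: "finite P" "P \<subseteq> {a..<a+1}"
    and conc: "\<And>s d. s \<in> P \<Longrightarrow> 0 < d \<Longrightarrow>
      eventually (\<lambda>k. c \<le> chain_energy \<alpha> (w k) \<lfloor>real (m k) * (s - d)\<rfloor> \<lfloor>real (m k) * (s + d)\<rfloor>) sequentially"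
  shows "real (card P) * c \<le> L"
proof (cases "P = {}")
  case True
  then show ?thesis using chain_energy_nonneg[OF \<alpha>, of "w 0" 0 "int (m 0)"] L[of 0] by simp
next
  case False
  \<comment> \<open>Adding the translates of P by 1 makes the separation hold around the circle.\<close>
  obtain e where e: "0 < e"
    "\<And>x y. x \<in> P \<union> (\<lambda>s. s + 1) ` P \<Longrightarrow> y \<in> P \<union> (\<lambda>s. s + 1) ` P \<Longrightarrow> x < y \<Longrightarrow> x + e \<le> y"
    using finite_separation[of "P \<union> (\<lambda>s. s + 1) ` P"] P(1) by auto
  define d where "d = e / 2"
  have d: "0 < d" using e(1) by (simp add: d_def)
  have sep: "s + d \<le> s' - d" if "s \<in> P" "s' \<in> P" "s < s'" for s s'
    using e(2)[of s s'] that by (simp add: d_def)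
  have wrap: "s + d \<le> s' + 1 - d" if "s \<in> P" "s' \<in> P" for s s'
  proof -
    have "s \<in> {a..<a+1}" "s' \<in> {a..<a+1}" using P(2) that by blast+
    then have "s < s' + 1" by simp
    then show ?thesis using e(2)[of s "s' + 1"] that by (simp add: d_def)
  qed
  \<comment> \<open>The period to which the energy is compared starts at the left end of the leftmost interval.\<close>
  define a' where "a' = Min P - d"
  have lo: "a' \<le> s - d" if "s \<in> P" for s using that P(1) by (simp add: a'_def)
  have hi: "s + d \<le> a' + 1" if "s \<in> P" for s
    using wrap[OF that Min_in[OF P(1) False]] by (simp add: a'_def)
  have "eventually (\<lambda>k. \<forall>s\<in>P. c \<le> chain_energy \<alpha> (w k) \<lfloor>real (m k) * (s - d)\<rfloor> \<lfloor>real (m k) * (s + d)\<rfloor>) sequentially"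
    using conc d by (intro eventually_ball_finite P(1)) auto
  then obtain k where k: "\<And>s. s \<in> P \<Longrightarrow> c \<le> chain_energy \<alpha> (w k) \<lfloor>real (m k) * (s - d)\<rfloor> \<lfloor>real (m k) * (s + d)\<rfloor>"
    using eventually_happens'[OF sequentially_bot] by blast
  define I where "I s = {\<lfloor>real (m k) * (s - d)\<rfloor>..<\<lfloor>real (m k) * (s + d)\<rfloor>}" for s
  define b where "b = \<lfloor>real (m k) * a'\<rfloor>"
  have fl: "\<lfloor>real (m k) * x\<rfloor> \<le> \<lfloor>real (m k) * y\<rfloor>" if "x \<le> y" for x y
    using that by (intro floor_mono mult_left_mono) auto
  have "real (m k) * (a' + 1) = real (m k) * a' + real_of_int (int (m k))" by (simp add: algebra_simps)
  then have b1: "\<lfloor>real (m k) * (a' + 1)\<rfloor> = b + int (m k)" unfolding b_def by (simp only: floor_add_int)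
  have disj: "I s \<inter> I s' = {}" if "s \<in> P" "s' \<in> P" "s \<noteq> s'" for s s'
  proof -
    have "\<lfloor>real (m k) * (s + d)\<rfloor> \<le> \<lfloor>real (m k) * (s' - d)\<rfloor> \<or> \<lfloor>real (m k) * (s' + d)\<rfloor> \<le> \<lfloor>real (m k) * (s - d)\<rfloor>"
      using sep[of s s'] sep[of s' s] that fl[of "s + d" "s' - d"] fl[of "s' + d" "s - d"]
      by (cases s s' rule: linorder_cases) auto
    then show ?thesis by (auto simp: I_def)
  qed
  let ?f = "\<lambda>i. bond_energy \<alpha> (w k i) (w k (i + 1))"
  have "real (card P) * c = (\<Sum>s\<in>P. c)" by simp
  also have "\<dots> \<le> (\<Sum>s\<in>P. sum ?f (I s))"
    using k by (intro sum_mono) (simp add: chain_energy_def I_def)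
  also have "\<dots> = sum ?f (\<Union>s\<in>P. I s)"
    using disj P(1) by (intro sum.UNION_disjoint[symmetric]) (auto simp: I_def)
  also have "\<dots> \<le> sum ?f {b..<b + int (m k)}"
  proof (rule sum_mono2)
    show "(\<Union>s\<in>P. I s) \<subseteq> {b..<b + int (m k)}"
    proof
      fix i assume "i \<in> (\<Union>s\<in>P. I s)"
      then obtain s where s: "s \<in> P" "i \<in> I s" by blast
      show "i \<in> {b..<b + int (m k)}"
        using s fl[OF lo[OF s(1)]] fl[OF hi[OF s(1)]] b1 by (auto simp: I_def b_def)
    qed
  qed (use \<alpha> bond_energy_nonneg_all_regimes in auto)
  also have "\<dots> = chain_energy \<alpha> (w k) 0 (int (m k))"
    using chain_energy_period[of "w k" "m k" \<alpha> b, OF per] by (simp add: chain_energy_def)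
  also have "\<dots> \<le> L" by (rule L)
  finally show ?thesis .
qed

lemma finite_concentration_points:
  fixes w :: "nat \<Rightarrow> int \<Rightarrow> real" and m :: "nat \<Rightarrow> nat"
  assumes \<alpha>: "0 \<le> \<alpha>"
    and per: "\<And>k i. w k (i + int (m k)) = w k i"
    and L: "\<And>k. chain_energy \<alpha> (w k) 0 (int (m k)) \<le> L"
    and c: "0 < c"
    and conc: "\<And>s d. s \<in> S \<Longrightarrow> 0 < d \<Longrightarrow>
      eventually (\<lambda>k. c \<le> chain_energy \<alpha> (w k) \<lfloor>real (m k) * (s - d)\<rfloor> \<lfloor>real (m k) * (s + d)\<rfloor>) sequentially"
  shows "finite (S \<inter> {a..b})"
proof -
  have unit: "finite (S \<inter> {x..<x+1})" for x
  proof -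
    have "card G \<le> nat \<lfloor>L / c\<rfloor>" if "G \<subseteq> S \<inter> {x..<x+1}" "finite G" for G
    proof -
      have "real (card G) * c \<le> L"
        by (rule card_concentration_points[where w=w and m=m, OF \<alpha> per L that(2)]) (use that conc in auto)
      then have "real (card G) \<le> L / c" using c by (simp add: field_simps)
      then show ?thesis by (simp add: le_nat_iff le_floor_iff)
    qed
    then show ?thesis using finite_if_finite_subsets_card_bdd by blast
  qed
  have "S \<inter> {a..b} \<subseteq> (\<Union>j\<in>{\<lfloor>a\<rfloor>..\<lfloor>b\<rfloor>}. S \<inter> {real_of_int j..<real_of_int j + 1})"
  proof
    fix x assume x: "x \<in> S \<inter> {a..b}"
    then have "\<lfloor>x\<rfloor> \<in> {\<lfloor>a\<rfloor>..\<lfloor>b\<rfloor>}" by (auto intro: floor_mono)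
    moreover have "x \<in> S \<inter> {real_of_int \<lfloor>x\<rfloor>..<real_of_int \<lfloor>x\<rfloor> + 1}" using x by auto
    ultimately show "x \<in> (\<Union>j\<in>{\<lfloor>a\<rfloor>..\<lfloor>b\<rfloor>}. S \<inter> {real_of_int j..<real_of_int j + 1})" by blast
  qed
  then show ?thesis by (rule finite_subset) (intro finite_UN_I unit finite_atLeastAtMost_int)
qed

text \<open>
  If \<open>\<rho> (u t) > c > 0\<close> then, by continuity, the single bond at \<open>t\<close> eventually costs more than \<open>c\<close>. By the
  preceding lemma such points \<open>t\<close> are locally finite for each \<open>c\<close>, hence countable altogether.
\<close>

lemma limit_in_wells:
  fixes w :: "nat \<Rightarrow> int \<Rightarrow> real" and m :: "nat \<Rightarrow> nat"
  assumes \<alpha>: "0 \<le> \<alpha>"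
    and per: "\<And>k i. w k (i + int (m k)) = w k i"
    and L: "\<And>k. chain_energy \<alpha> (w k) 0 (int (m k)) \<le> L"
    and m: "filterlim m at_top sequentially"
    and \<rho>: "continuous_on UNIV \<rho>" "\<And>k i. \<rho> (w k i) \<le> bond_energy \<alpha> (w k i) (w k (i + 1))"
    and lim: "AE t in lebesgue. (\<lambda>k. w k \<lfloor>real (m k) * t\<rfloor>) \<longlonglongrightarrow> u t"
  shows "AE t in lebesgue. \<rho> (u t) \<le> (0::real)"
proof -
  define B where "B c = {t. (\<lambda>k. w k \<lfloor>real (m k) * t\<rfloor>) \<longlonglongrightarrow> u t \<and> c < \<rho> (u t)}" for c
  have mr: "filterlim (\<lambda>k. real (m k)) at_top sequentially"
    by (rule filterlim_compose[OF filterlim_real_sequentially m])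
  have fin: "finite (B c \<inter> {a..b})" if c: "0 < c" for c a b
  proof (rule finite_concentration_points[where w=w and m=m, OF \<alpha> per L c])
    fix s d :: real assume s: "s \<in> B c" and d: "0 < d"
    have "(\<lambda>k. \<rho> (w k \<lfloor>real (m k) * s\<rfloor>)) \<longlonglongrightarrow> \<rho> (u s)"
    proof (rule isCont_tendsto_compose[of _ \<rho>])
      show "isCont \<rho> (u s)" using \<rho>(1) by (simp add: continuous_on_eq_continuous_at)
    qed (use s in \<open>simp add: B_def\<close>)
    then have ev1: "eventually (\<lambda>k. c < \<rho> (w k \<lfloor>real (m k) * s\<rfloor>)) sequentially"
      by (rule order_tendstoD(1)) (use s in \<open>simp add: B_def\<close>)
    have ev2: "eventually (\<lambda>k. 1 / d \<le> real (m k)) sequentially"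
      using mr by (auto simp: filterlim_at_top)
    from ev1 ev2 show "eventually (\<lambda>k. c \<le> chain_energy \<alpha> (w k) \<lfloor>real (m k) * (s - d)\<rfloor> \<lfloor>real (m k) * (s + d)\<rfloor>) sequentially"
    proof eventually_elim
      case (elim k)
      define i where "i = \<lfloor>real (m k) * s\<rfloor>"
      have md: "1 \<le> real (m k) * d" using elim(2) d by (simp add: field_simps)
      have "\<lfloor>real (m k) * (s - d)\<rfloor> \<le> i" unfolding i_def
        using d by (intro floor_mono mult_left_mono) auto
      moreover have "i + 1 \<le> \<lfloor>real (m k) * (s + d)\<rfloor>" unfolding i_def
      proof -
        have "real_of_int \<lfloor>real (m k) * s\<rfloor> \<le> real (m k) * s" by simp
        then show "\<lfloor>real (m k) * s\<rfloor> + 1 \<le> \<lfloor>real (m k) * (s + d)\<rfloor>"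
          using md by (simp only: le_floor_iff of_int_add of_int_1 distrib_left)
      qed
      ultimately have "chain_energy \<alpha> (w k) i (i + 1) \<le> chain_energy \<alpha> (w k) \<lfloor>real (m k) * (s - d)\<rfloor> \<lfloor>real (m k) * (s + d)\<rfloor>"
        by (intro chain_energy_mono \<alpha>)
      moreover have "chain_energy \<alpha> (w k) i (i + 1) = bond_energy \<alpha> (w k i) (w k (i + 1))"
      proof -
        have "{i..<i+1} = {i}" by auto
        then show ?thesis by (simp add: chain_energy_def)
      qed
      ultimately show ?case using elim(1) \<rho>(2)[of k i] by (simp add: i_def)
    qed
  qed
  have cnt: "countable (\<Union>j. \<Union>n. B (1 / real (Suc j)) \<inter> {- real n..real n})"
    by (intro countable_UN countable_finite[OF fin]) auto
  show ?thesis
    using lim AE_lebesgue_not_in_countable[OF cnt]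
  proof eventually_elim
    case (elim t)
    show ?case
    proof (rule ccontr)
      assume "\<not> \<rho> (u t) \<le> 0"
      then obtain j where "1 / real (Suc j) < \<rho> (u t)"
        using reals_Archimedean[of "\<rho> (u t)"] by (auto simp: inverse_eq_divide)
      then have "t \<in> B (1 / real (Suc j))" using elim(1) by (simp add: B_def)
      moreover obtain n where n: "\<bar>t\<bar> \<le> real n" using real_arch_simple by blast
      moreover from n have "t \<in> {- real n..real n}" by (simp add: abs_le_iff)
      ultimately show False using elim(2) by blast
    qed
  qed
qed

section \<open>Compactness and the lower bound\<close>

text \<open>
  The two bonds that join the piece of the chain to the wells tend to bonds inside a well, which cost nothing.
  Downward transitions reduce to upward ones because the bond energy is even.
\<close>

lemma transition_cost_eventually:
  fixes w :: "nat \<Rightarrow> int \<Rightarrow> real" and m :: "nat \<Rightarrow> nat"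
  assumes \<alpha>: "0 \<le> \<alpha>" "\<alpha> < 4" and w: "\<And>k i. w k i \<in> {-pi/2..pi/2}"
    and xy: "x \<le> y" and c: "c < crease_energy \<alpha>"
    and x: "(\<lambda>k. w k \<lfloor>real (m k) * x\<rfloor>) \<longlonglongrightarrow> p" and y: "(\<lambda>k. w k \<lfloor>real (m k) * y\<rfloor>) \<longlonglongrightarrow> - p"
    and p: "p \<in> {crease_angle \<alpha>, - crease_angle \<alpha>}"
  shows "eventually (\<lambda>k. c \<le> chain_energy \<alpha> (w k) \<lfloor>real (m k) * x\<rfloor> \<lfloor>real (m k) * y\<rfloor>) sequentially"
proof -
  have up: "eventually (\<lambda>k. c \<le> chain_energy \<alpha> (v k) \<lfloor>real (m k) * x\<rfloor> \<lfloor>real (m k) * y\<rfloor>) sequentially"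
    if v: "\<And>k i. v k i \<in> {-pi/2..pi/2}"
      and x: "(\<lambda>k. v k \<lfloor>real (m k) * x\<rfloor>) \<longlonglongrightarrow> - crease_angle \<alpha>"
      and y: "(\<lambda>k. v k \<lfloor>real (m k) * y\<rfloor>) \<longlonglongrightarrow> crease_angle \<alpha>"
    for v :: "nat \<Rightarrow> int \<Rightarrow> real"
  proof -
    let ?r = "\<lambda>k. bond_energy \<alpha> (- crease_angle \<alpha>) (v k \<lfloor>real (m k) * x\<rfloor>)
        + bond_energy \<alpha> (v k \<lfloor>real (m k) * y\<rfloor>) (crease_angle \<alpha>)"
    have "?r \<longlonglongrightarrow> bond_energy \<alpha> (- crease_angle \<alpha>) (- crease_angle \<alpha>)
        + bond_energy \<alpha> (crease_angle \<alpha>) (crease_angle \<alpha>)"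
      by (intro tendsto_intros x y)
    moreover have "bond_energy \<alpha> (- crease_angle \<alpha>) (- crease_angle \<alpha>)
        + bond_energy \<alpha> (crease_angle \<alpha>) (crease_angle \<alpha>) = 0"
      using bond_energy_crease_angle[of \<alpha>] \<alpha> by simp
    ultimately have "?r \<longlonglongrightarrow> 0" by simp
    then have "eventually (\<lambda>k. ?r k < crease_energy \<alpha> - c) sequentially"
      by (rule order_tendstoD) (use c in simp)
    then show ?thesis
    proof eventually_elim
      case (elim k)
      have "\<lfloor>real (m k) * x\<rfloor> \<le> \<lfloor>real (m k) * y\<rfloor>"
        using xy by (intro floor_mono mult_left_mono) auto
      from crease_energy_le_chain[OF \<alpha> this, of "v k"] v[of k] elim show ?case by simp
    qed
  qed
  show ?thesis
  proof (cases "p = crease_angle \<alpha>")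
    case True
    have "eventually (\<lambda>k. c \<le> chain_energy \<alpha> (\<lambda>i. - w k i) \<lfloor>real (m k) * x\<rfloor> \<lfloor>real (m k) * y\<rfloor>) sequentially"
    proof (rule up)
      show "- w k i \<in> {-pi/2..pi/2}" for k i using w[of k i] by auto
      show "(\<lambda>k. - w k \<lfloor>real (m k) * x\<rfloor>) \<longlonglongrightarrow> - crease_angle \<alpha>"
        using tendsto_minus[OF x] True by simp
      show "(\<lambda>k. - w k \<lfloor>real (m k) * y\<rfloor>) \<longlonglongrightarrow> crease_angle \<alpha>"
        using tendsto_minus[OF y] True by simp
    qed
    then show ?thesis by (simp add: chain_energy_uminus)
  next
    case False
    then have "p = - crease_angle \<alpha>" using p by simp
    then show ?thesis using up[of w, OF w] x y by simp
  qed
qed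

text \<open>
  Almost-everywhere classes have no pointwise values, so oscillation near \<open>s\<close> is tested on a set
  \<open>G\<close> of full measure. Isolated exceptional values at points of \<open>G\<close> also count; this is harmless as only
  local finiteness is wanted.
\<close>

definition essential_discontinuities :: "real set \<Rightarrow> (real \<Rightarrow> real) \<Rightarrow> real set" where
  "essential_discontinuities G u =
     {s. \<forall>d>0. \<exists>x\<in>G. \<exists>y\<in>G. s - d < x \<and> x < y \<and> y < s + d \<and> u x \<noteq> u y}"

text \<open>
  Off the discontinuities, \<open>u\<close> is constant on the part of \<open>G\<close> in some neighbourhood. These local
  constants form the representative \<open>g\<close>: it is locally constant away from the discontinuities, hence constant on every
  interval that avoids them.
\<close>

lemma PC_loc_if_locally_finite_discontinuities:
  assumes G: "AE t in lebesgue. t \<in> G"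
    and fin: "\<And>a b. finite (essential_discontinuities G u \<inter> {a..b})"
  shows "u \<in> PC_loc"
proof -
  let ?S = "essential_discontinuities G u"
  have ex: "\<exists>c. \<exists>d>0. \<forall>x\<in>G. \<bar>x - t\<bar> < d \<longrightarrow> u x = c" if t: "t \<notin> ?S" for t
  proof -
    obtain d where d: "d > 0" "\<And>x y. x \<in> G \<Longrightarrow> y \<in> G \<Longrightarrow> t - d < x \<Longrightarrow> x < y \<Longrightarrow> y < t + d \<Longrightarrow> u x = u y"
      using t unfolding essential_discontinuities_def mem_Collect_eq by blast
    obtain z where z: "z \<in> G" "t - d < z" "z < t + d"
      using AE_lebesgue_ex[OF G, of "t - d" "t + d"] d(1) by auto
    have "u x = u z" if "x \<in> G" "\<bar>x - t\<bar> < d" for x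
    proof -
      have "t - d < x" "x < t + d" using that(2) by (auto simp: abs_less_iff)
      then show ?thesis
        using d(2)[OF that(1) z(1)] d(2)[OF z(1) that(1)] z(2,3) by (metis linorder_neqE)
    qed
    then show ?thesis using d(1) by blast
  qed
  define g where "g t = (SOME c. \<exists>d>0. \<forall>x\<in>G. \<bar>x - t\<bar> < d \<longrightarrow> u x = c)" for t
  have g: "\<exists>d>0. \<forall>x\<in>G. \<bar>x - t\<bar> < d \<longrightarrow> u x = g t" if "t \<notin> ?S" for t
    unfolding g_def using someI_ex[OF ex[OF that]] by simp
  have const: "g constant_on {a<..<b}" if ab: "{a<..<b} \<inter> ?S = {}" for a b
  proof (cases "a < b")
    case True
    have loc: "eventually (\<lambda>x. g t = g x) (at t within {a<..<b})" if t: "t \<in> {a<..<b}" for t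
    proof -
      have "t \<notin> ?S" using ab t by blast
      then obtain d where d: "d > 0" "\<And>x. x \<in> G \<Longrightarrow> \<bar>x - t\<bar> < d \<Longrightarrow> u x = g t" using g by blast
      have "g t = g x" if x: "x \<in> {a<..<b}" "dist x t < d" for x
      proof -
        have "x \<notin> ?S" using ab x by blast
        then obtain e where e: "e > 0" "\<And>z. z \<in> G \<Longrightarrow> \<bar>z - x\<bar> < e \<Longrightarrow> u z = g x" using g by blast
        define lo hi where "lo = max (x - e) (t - d)" and "hi = min (x + e) (t + d)"
        have "lo < hi" using x(2) e(1) d(1) by (auto simp: lo_def hi_def dist_real_def abs_less_iff)
        then obtain z where "z \<in> G" "lo < z" "z < hi" using AE_lebesgue_ex[OF G, of lo hi] by auto
        then show ?thesis using d(2)[of z] e(2)[of z] by (auto simp: lo_def hi_def abs_less_iff)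
      qed
      then show ?thesis using d(1) unfolding eventually_at by blast
    qed
    have "g x = g ((a+b)/2)" if "x \<in> {a<..<b}" for x
      by (rule connected_local_const[of "{a<..<b}"]) (use that True loc in auto)
    then show ?thesis unfolding constant_on_def by blast
  qed (simp add: constant_on_def)
  have "AE t in lebesgue. u t = g t"
    using G AE_lebesgue_not_in_countable[OF countable_locally_finite[OF fin]]
  proof eventually_elim
    case (elim t)
    then obtain d where "d > 0" "\<And>x. x \<in> G \<Longrightarrow> \<bar>x - t\<bar> < d \<Longrightarrow> u x = g t" using g by blast
    then show ?case using elim(1) by simp
  qed
  then show ?thesis unfolding PC_loc_def using fin const by blast
qed

lemma jump_set_subset_essential_discontinuities:
  assumes G: "AE t in lebesgue. t \<in> G"
  shows "jump_set u \<subseteq> essential_discontinuities G u"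
proof
  fix s assume "s \<in> jump_set u"
  then obtain l r where lr: "ess_lim_left u s l" "ess_lim_right u s r" "l \<noteq> r"
    by (auto simp: jump_set_def)
  define e where "e = \<bar>l - r\<bar> / 2"
  have e: "e > 0" using lr(3) by (simp add: e_def)
  obtain d1 where d1: "d1 > 0" "AE x in lebesgue. x \<in> {s - d1<..<s} \<longrightarrow> \<bar>u x - l\<bar> < e"
    using lr(1) e by (auto simp: ess_lim_left_def)
  obtain d2 where d2: "d2 > 0" "AE x in lebesgue. x \<in> {s<..<s + d2} \<longrightarrow> \<bar>u x - r\<bar> < e"
    using lr(2) e by (auto simp: ess_lim_right_def)
  show "s \<in> essential_discontinuities G u"
    unfolding essential_discontinuities_def
  proof (intro CollectI allI impI)
    fix d :: real assume d: "d > 0"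
    have "AE x in lebesgue. x \<in> G \<and> (x \<in> {s - d1<..<s} \<longrightarrow> \<bar>u x - l\<bar> < e)"
      using G d1(2) by eventually_elim simp
    from AE_lebesgue_ex[OF this, of "s - min d d1" s] d d1(1)
    obtain x where x: "x \<in> G" "s - d < x" "x < s" "\<bar>u x - l\<bar> < e" by auto
    have "AE x in lebesgue. x \<in> G \<and> (x \<in> {s<..<s + d2} \<longrightarrow> \<bar>u x - r\<bar> < e)"
      using G d2(2) by eventually_elim simp
    from AE_lebesgue_ex[OF this, of s "s + min d d2"] d d2(1)
    obtain y where y: "y \<in> G" "s < y" "y < s + d" "\<bar>u y - r\<bar> < e" by auto
    have "u x \<noteq> u y" using x(4) y(4) by (auto simp: e_def abs_if split: if_splits)
    then show "\<exists>x\<in>G. \<exists>y\<in>G. s - d < x \<and> x < y \<and> y < s + d \<and> u x \<noteq> u y"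
      using x y by (intro bexI[of _ x] bexI[of _ y]) auto
  qed
qed

text \<open>
  Concentration holds with every constant \<open>c < C\<^sub>\<alpha>\<close> and is used in two steps: a positive constant such
  as \<open>C\<^sub>\<alpha>/2\<close> makes the discontinuities locally finite, and then, for the finite set of jumps in a period,
  letting \<open>c\<close> tend to \<open>C\<^sub>\<alpha>\<close> gives the sharp bound on their number.
\<close>

lemma crease_lower_bound:
  fixes w :: "nat \<Rightarrow> int \<Rightarrow> real" and m :: "nat \<Rightarrow> nat"
  assumes \<alpha>: "0 \<le> \<alpha>" "\<alpha> < 4"
    and per: "\<And>k i. w k (i + int (m k)) = w k i"
    and w: "\<And>k i. w k i \<in> {-pi/2..pi/2}"
    and L: "\<And>k. chain_energy \<alpha> (w k) 0 (int (m k)) \<le> L"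
    and m: "filterlim m at_top sequentially"
    and lim: "AE t in lebesgue. (\<lambda>k. w k \<lfloor>real (m k) * t\<rfloor>) \<longlonglongrightarrow> u t"
  shows "E_crease \<alpha> u \<le> ereal L"
proof -
  let ?p = "crease_angle \<alpha>"
  have \<alpha>': "\<alpha> \<le> 4" using \<alpha> by simp
  define G where "G = {t. (\<lambda>k. w k \<lfloor>real (m k) * t\<rfloor>) \<longlonglongrightarrow> u t \<and> u t \<in> {?p, - ?p}}"
  have "AE t in lebesgue. (cos (u t) - \<alpha> / 4)^4 / 4 \<le> 0"
    by (rule limit_in_wells[where \<rho>="\<lambda>x. (cos x - \<alpha> / 4)^4 / 4", OF \<alpha>(1) per L m _ _ lim])
       (use w well_defect_le_bond_energy \<alpha>(1) \<alpha>' in \<open>auto intro!: continuous_intros\<close>)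
  then have G: "AE t in lebesgue. t \<in> G"
    using lim
  proof eventually_elim
    case (elim t)
    have "0 \<le> (cos (u t) - \<alpha> / 4)^4" by simp
    then have "cos (u t) = \<alpha> / 4" using elim(1) by simp
    moreover have "u t \<in> {-pi/2..pi/2}"
      by (rule closed_sequentially[OF closed_atLeastAtMost _ elim(2)]) (rule w)
    ultimately show ?case using cos_eq_crease_angle[OF \<alpha>] elim(2) by (simp add: G_def)
  qed
  have conc: "eventually (\<lambda>k. c \<le> chain_energy \<alpha> (w k) \<lfloor>real (m k) * (s - d)\<rfloor> \<lfloor>real (m k) * (s + d)\<rfloor>) sequentially"
    if s: "s \<in> essential_discontinuities G u" and d: "0 < d" and c: "c < crease_energy \<alpha>" for s d c
  proof -
    obtain x y where xy: "x \<in> G" "y \<in> G" "s - d < x" "x < y" "y < s + d" "u x \<noteq> u y"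
      using s d by (auto simp: essential_discontinuities_def)
    have uy: "u y = - u x" using xy(1,2,6) by (auto simp: G_def)
    have "eventually (\<lambda>k. c \<le> chain_energy \<alpha> (w k) \<lfloor>real (m k) * x\<rfloor> \<lfloor>real (m k) * y\<rfloor>) sequentially"
    proof (rule transition_cost_eventually[OF \<alpha> w _ c])
      show "(\<lambda>k. w k \<lfloor>real (m k) * y\<rfloor>) \<longlonglongrightarrow> - u x" using xy(2) uy by (simp add: G_def)
    qed (use xy in \<open>auto simp: G_def\<close>)
    then show ?thesis
    proof eventually_elim
      case (elim k)
      have "chain_energy \<alpha> (w k) \<lfloor>real (m k) * x\<rfloor> \<lfloor>real (m k) * y\<rfloor>
          \<le> chain_energy \<alpha> (w k) \<lfloor>real (m k) * (s - d)\<rfloor> \<lfloor>real (m k) * (s + d)\<rfloor>"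
        using xy by (intro chain_energy_mono \<alpha> floor_mono mult_left_mono) auto
      then show ?case using elim by simp
    qed
  qed
  have C: "0 < crease_energy \<alpha>" by (rule crease_energy_pos[OF \<alpha>])
  have fin: "finite (essential_discontinuities G u \<inter> {a..b})" for a b
  proof (rule finite_concentration_points[where w=w and m=m and c="crease_energy \<alpha> / 2", OF \<alpha>(1) per L])
    show "eventually (\<lambda>k. crease_energy \<alpha> / 2 \<le> chain_energy \<alpha> (w k) \<lfloor>real (m k) * (s - d)\<rfloor> \<lfloor>real (m k) * (s + d)\<rfloor>) sequentially"
      if "s \<in> essential_discontinuities G u" "0 < d" for s d
      by (rule conc[OF that]) (use C in simp)
  qed (use C in simp)
  have PC: "u \<in> PC_loc" by (rule PC_loc_if_locally_finite_discontinuities[OF G fin])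
  have wells: "AE t in lebesgue. u t \<in> {?p, - ?p}"
    using G by eventually_elim (simp add: G_def)
  have periodic: "AE t in lebesgue. u (t + 1) = u t"
    using lim AE_lebesgue_shift[OF lim, of 1]
  proof eventually_elim
    case (elim t)
    have "\<lfloor>real (m k) * (t + 1)\<rfloor> = \<lfloor>real (m k) * t\<rfloor> + int (m k)" for k
    proof -
      have "real (m k) * (t + 1) = real (m k) * t + real_of_int (int (m k))" by (simp add: algebra_simps)
      then show ?thesis by (simp only: floor_add_int)
    qed
    then have "(\<lambda>k. w k \<lfloor>real (m k) * t\<rfloor>) \<longlonglongrightarrow> u (t + 1)" using elim(2) per by simp
    then show ?case using elim(1) LIMSEQ_unique by blast
  qed
  define P where "P = jump_set u \<inter> {0..<1}"
  have P: "P \<subseteq> essential_discontinuities G u"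
    using jump_set_subset_essential_discontinuities[OF G] by (auto simp: P_def)
  have finP: "finite P" by (rule finite_subset[OF _ fin[of 0 1]]) (use P in \<open>auto simp: P_def\<close>)
  have bound: "real (card P) * c \<le> L" if "c < crease_energy \<alpha>" for c
    by (rule card_concentration_points[where w=w and m=m and a=0, OF \<alpha>(1) per L finP])
       (use P conc that in \<open>auto simp: P_def\<close>)
  have "crease_energy \<alpha> * real (card P) \<le> L"
  proof (cases "card P = 0")
    case True
    then show ?thesis using bound[of 0] C by simp
  next
    case False
    have "crease_energy \<alpha> \<le> L / real (card P)"
      by (rule dense_le) (use bound False in \<open>simp add: field_simps\<close>)
    then show ?thesis using False by (simp add: field_simps)
  qed
  then show ?thesis using PC wells periodic by (simp add: E_crease_def P_def)
qed

lemma flat_lower_bound: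
  fixes w :: "nat \<Rightarrow> int \<Rightarrow> real" and m :: "nat \<Rightarrow> nat"
  assumes \<alpha>: "4 \<le> \<alpha>"
    and per: "\<And>k i. w k (i + int (m k)) = w k i"
    and w: "\<And>k i. w k i \<in> {-pi/2..pi/2}"
    and L: "\<And>k. chain_energy \<alpha> (w k) 0 (int (m k)) \<le> L"
    and m: "filterlim m at_top sequentially"
    and lim: "AE t in lebesgue. (\<lambda>k. w k \<lfloor>real (m k) * t\<rfloor>) \<longlonglongrightarrow> u t"
  shows "E_flat u \<le> ereal L"
proof -
  have \<alpha>': "0 \<le> \<alpha>" using \<alpha> by simp
  have "AE t in lebesgue. (cos (u t) - 1)^2 / 2 \<le> 0"
    by (rule limit_in_wells[where \<rho>="\<lambda>x. (cos x - 1)^2 / 2", OF \<alpha>' per L m _ _ lim])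
       (use flat_defect_le_bond_energy \<alpha> in \<open>auto intro!: continuous_intros\<close>)
  then have "AE t in lebesgue. u t = 0"
    using lim
  proof eventually_elim
    case (elim t)
    have "cos (u t) = 1" using elim(1) by simp
    moreover have "u t \<in> {-pi/2..pi/2}"
      by (rule closed_sequentially[OF closed_atLeastAtMost _ elim(2)]) (rule w)
    then have "arccos (cos \<bar>u t\<bar>) = \<bar>u t\<bar>"
      by (intro arccos_cos) (use pi_gt_zero in \<open>auto simp: abs_le_iff\<close>)
    ultimately show ?case by simp
  qed
  moreover have "0 \<le> L" using chain_energy_nonneg[OF \<alpha>', of "w 0" 0 "int (m 0)"] L[of 0] by simp
  ultimately show ?thesis by (simp add: E_flat_def)
qed

text \<open>
  Convergence in \<open>L\<^sup>1\<^sub>l\<^sub>o\<^sub>c\<close> is turned into convergence of one global sequence of integrals by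
  cutting off the \<open>k\<close>-th difference to \<open>[-k, k]\<close> and going so far in the original sequence that its integral is below
  \<open>1/(k+1)\<close>. At a fixed \<open>t\<close> the cut-off is eventually inactive.
\<close>

lemma energy_bounded_subsequence:
  assumes us: "\<And>n. us n \<in> L1_loc" and u: "u \<in> L1_loc"
    and conv: "tendsto_L1_loc us u"
    and lt: "liminf (\<lambda>n. F n (us n)) < (L :: ereal)"
  obtains m :: "nat \<Rightarrow> nat" where "filterlim m at_top sequentially" "\<And>k. 0 < m k"
    "\<And>k. F (m k) (us (m k)) < L" "AE t in lebesgue. (\<lambda>k. us (m k) t) \<longlonglongrightarrow> u t"
proof -
  define I where "I k n = (LINT t:{- real k..real k}|lebesgue. \<bar>us n t - u t\<bar>)" for k n
  have "\<exists>n\<ge>Suc k. F n (us n) < L \<and> I k n < inverse (real (Suc k))" for k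
  proof -
    have freq: "frequently (\<lambda>n. F n (us n) < L) sequentially"
    proof (rule ccontr)
      assume "\<not> ?thesis"
      then have "eventually (\<lambda>n. L \<le> F n (us n)) sequentially"
        by (simp add: not_frequently not_less)
      then have "L \<le> liminf (\<lambda>n. F n (us n))" by (rule Liminf_bounded)
      then show False using lt by simp
    qed
    have "(\<lambda>n. I k n) \<longlonglongrightarrow> 0" using conv by (simp add: I_def tendsto_L1_loc_def)
    then have "eventually (\<lambda>n. I k n < inverse (real (Suc k))) sequentially"
      by (rule order_tendstoD) simp
    then have "eventually (\<lambda>n. Suc k \<le> n \<and> I k n < inverse (real (Suc k))) sequentially"
      using eventually_ge_at_top[of "Suc k"] by eventually_elim simp
    from frequently_ex[OF frequently_eventually_conj[OF freq this]] show ?thesis by blast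
  qed
  then obtain r where r: "\<And>k. Suc k \<le> r k" "\<And>k. F (r k) (us (r k)) < L"
      "\<And>k. I k (r k) < inverse (real (Suc k))"
    by metis
  define f where "f k t = indicator {- real k..real k} t * \<bar>us (r k) t - u t\<bar>" for k t
  have int: "integrable lebesgue (f k)" for k
  proof -
    have "set_integrable lebesgue {- real k..real k} (us (r k))" "set_integrable lebesgue {- real k..real k} u"
      using us[of "r k"] u by (auto simp: L1_loc_def)
    then have "set_integrable lebesgue {- real k..real k} (\<lambda>t. \<bar>us (r k) t - u t\<bar>)"
      by (intro set_integrable_abs set_integral_diff)
    then show ?thesis by (simp add: set_integrable_def f_def[abs_def])
  qed
  have nrm: "(\<integral>t. norm (f k t) \<partial>lebesgue) = I k (r k)" for k
    by (simp add: I_def set_lebesgue_integral_def f_def abs_mult)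
  have "(\<lambda>k. \<integral>t. norm (f k t) \<partial>lebesgue) \<longlonglongrightarrow> 0"
  proof (rule tendsto_sandwich[OF _ _ tendsto_const LIMSEQ_inverse_real_of_nat])
    show "eventually (\<lambda>k. 0 \<le> (\<integral>t. norm (f k t) \<partial>lebesgue)) sequentially" by simp
    show "eventually (\<lambda>k. (\<integral>t. norm (f k t) \<partial>lebesgue) \<le> inverse (real (Suc k))) sequentially"
      unfolding nrm using r(3) by (intro always_eventually allI less_imp_le)
  qed
  then obtain q where q: "strict_mono q" "AE t in lebesgue. (\<lambda>k. f (q k) t) \<longlonglongrightarrow> 0"
    using tendsto_L1_AE_subseq[of lebesgue f, OF int] by blast
  have ge: "k \<le> r (q k)" for k
    using r(1)[of "q k"] seq_suble[OF q(1), of k] by simp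
  show ?thesis
  proof (rule that[of "\<lambda>k. r (q k)"])
    show "filterlim (\<lambda>k. r (q k)) at_top sequentially"
      by (rule filterlim_at_top_mono[OF filterlim_ident]) (simp add: ge)
    show "0 < r (q k)" for k using r(1)[of "q k"] by simp
    show "F (r (q k)) (us (r (q k))) < L" for k by (rule r(2))
    show "AE t in lebesgue. (\<lambda>k. us (r (q k)) t) \<longlonglongrightarrow> u t"
      using q(2)
    proof eventually_elim
      case (elim t)
      obtain K where K: "\<bar>t\<bar> \<le> real K" using real_arch_simple by blast
      have "eventually (\<lambda>k. f (q k) t = \<bar>us (r (q k)) t - u t\<bar>) sequentially"
        using eventually_ge_at_top[of K]
      proof eventually_elim
        case (elim k)
        have "real K \<le> real (q k)" using elim seq_suble[OF q(1), of k] by simp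
        then have "\<bar>t\<bar> \<le> real (q k)" using K by linarith
        then show ?case by (simp add: f_def abs_le_iff indicator_def)
      qed
      from Lim_transform_eventually[OF elim this] show ?case
        by (simp add: tendsto_rabs_zero_iff LIM_zero_iff)
    qed
  qed
qed

text \<open>
  The passage from lattice functions with bounded energy to the \<open>liminf\<close> inequality, shared
  by the two regimes of \<open>\<alpha>\<close>: it suffices to bound the limit energy at almost-everywhere limits.
\<close>

lemma liminf_inequality:
  assumes lower: "\<And>(w :: nat \<Rightarrow> int \<Rightarrow> real) (m :: nat \<Rightarrow> nat) L.
      (\<And>k i. w k (i + int (m k)) = w k i) \<Longrightarrow> (\<And>k i. w k i \<in> {-pi/2..pi/2}) \<Longrightarrow>
      (\<And>k. chain_energy \<alpha> (w k) 0 (int (m k)) \<le> L) \<Longrightarrow> filterlim m at_top sequentially \<Longrightarrow>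
      (AE t in lebesgue. (\<lambda>k. w k \<lfloor>real (m k) * t\<rfloor>) \<longlonglongrightarrow> u t) \<Longrightarrow> F u \<le> ereal L"
    and us: "\<And>n. us n \<in> L1_loc" and u: "u \<in> L1_loc" and conv: "tendsto_L1_loc us u"
  shows "F u \<le> liminf (\<lambda>n. E_n n \<alpha> (us n))"
proof (rule dense_ge)
  fix L assume "liminf (\<lambda>n. E_n n \<alpha> (us n)) < L"
  then obtain m :: "nat \<Rightarrow> nat" where m: "filterlim m at_top sequentially" "\<And>k. 0 < m k"
      "\<And>k. E_n (m k) \<alpha> (us (m k)) < L" "AE t in lebesgue. (\<lambda>k. us (m k) t) \<longlonglongrightarrow> u t"
    using energy_bounded_subsequence[where F="\<lambda>n. E_n n \<alpha>", OF us u conv] by blast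
  have "\<exists>v. v \<in> lattice_functions (m k) \<and> (AE t in lebesgue. us (m k) t = periodize (m k) v \<lfloor>real (m k) * t\<rfloor>) \<and>
    E_n (m k) \<alpha> (us (m k)) = ereal (chain_energy \<alpha> (periodize (m k) v) 0 (int (m k)))" for k
  proof -
    have "E_n (m k) \<alpha> (us (m k)) < \<infinity>" using m(3)[of k] by auto
    from E_n_finite_obtain[OF this m(2)] show ?thesis by metis
  qed
  then obtain v where v: "\<And>k. v k \<in> lattice_functions (m k)"
      "\<And>k. AE t in lebesgue. us (m k) t = periodize (m k) (v k) \<lfloor>real (m k) * t\<rfloor>"
      "\<And>k. E_n (m k) \<alpha> (us (m k)) = ereal (chain_energy \<alpha> (periodize (m k) (v k)) 0 (int (m k)))"
    by metis
  have lt: "ereal (chain_energy \<alpha> (periodize (m k) (v k)) 0 (int (m k))) < L" for k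
    using m(3)[of k] v(3)[of k] by simp
  show "F u \<le> L"
  proof (cases L)
    case (real l)
    have "F u \<le> ereal l"
    proof (rule lower[of "\<lambda>k. periodize (m k) (v k)" m])
      show "AE t in lebesgue. (\<lambda>k. periodize (m k) (v k) \<lfloor>real (m k) * t\<rfloor>) \<longlonglongrightarrow> u t"
      proof -
        have "AE t in lebesgue. \<forall>k. us (m k) t = periodize (m k) (v k) \<lfloor>real (m k) * t\<rfloor>"
          using v(2) by (simp add: AE_all_countable)
        then show ?thesis using m(4) by eventually_elim simp
      qed
      show "chain_energy \<alpha> (periodize (m k) (v k)) 0 (int (m k)) \<le> l" for k
        using lt[of k] real by simp
    qed (use periodize_add periodize_range v(1) m in auto)
    then show ?thesis using real by simp
  qed (use lt[of 0] in auto)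
qed

section \<open>Piecewise constant limits\<close>

text \<open>
  The right limits of a piecewise constant representative form a function \<open>h\<close> that is
  defined everywhere, takes only the two values and is exactly periodic. It carries along the facts about the jump set
  on which the construction of recovery sequences relies; in particular, with only two values available, crossing a
  jump means changing sign.
\<close>

lemma two_valued_step_representative:
  assumes PC: "u \<in> PC_loc"
    and wells: "AE t in lebesgue. u t \<in> {p, - p}"
    and periodic: "AE t in lebesgue. u (t + 1) = u t"
  obtains h :: "real \<Rightarrow> real" where
    "\<And>t. h t \<in> {p, - p}" "\<And>t. h (t + 1) = h t" "AE t in lebesgue. u t = h t"
    "\<And>a b. a \<le> b \<Longrightarrow> {a<..b} \<inter> jump_set u = {} \<Longrightarrow> h a = h b"
    "\<And>s. s \<in> jump_set u \<Longrightarrow> \<exists>d>0. \<forall>t. s - d < t \<and> t < s \<longrightarrow> h t = - h s"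
    "\<And>a b. finite (jump_set u \<inter> {a..b})"
    "\<And>s. s + 1 \<in> jump_set u \<longleftrightarrow> s \<in> jump_set u"
proof -
  obtain g S where S: "\<And>a b. finite (S \<inter> {a..b})"
    and g: "\<And>a b. {a<..<b} \<inter> S = {} \<Longrightarrow> g constant_on {a<..<b}"
    and ug: "AE t in lebesgue. u t = g t"
    using PC unfolding PC_loc_def by blast
  have isolated: "\<exists>d>0. \<forall>x. \<bar>x - t\<bar> < d \<and> x \<noteq> t \<longrightarrow> x \<notin> S" for t
  proof -
    obtain d where d: "d > 0" "\<And>x. x \<in> S \<inter> {t - 1..t + 1} \<Longrightarrow> x \<noteq> t \<Longrightarrow> d \<le> dist t x"
      using finite_set_avoid[OF S[of "t - 1" "t + 1"], of t] by blast
    have "x \<notin> S" if "\<bar>x - t\<bar> < min d 1" "x \<noteq> t" for x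
      using d(2)[of x] that by (auto simp: dist_real_def abs_if split: if_splits)
    then show ?thesis using d(1) by (intro exI[of _ "min d 1"]) auto
  qed
  have "\<exists>r l d. d > 0 \<and> (\<forall>x. t < x \<and> x < t + d \<longrightarrow> g x = r) \<and> (\<forall>x. t - d < x \<and> x < t \<longrightarrow> g x = l)
      \<and> (t \<notin> S \<longrightarrow> r = g t \<and> l = g t)" for t
  proof -
    obtain d where d: "d > 0" "\<And>x. \<bar>x - t\<bar> < d \<Longrightarrow> x \<noteq> t \<Longrightarrow> x \<notin> S" using isolated by blast
    show ?thesis
    proof (cases "t \<in> S")
      case True
      have "g constant_on {t<..<t+d}" "g constant_on {t-d<..<t}"
        by (rule g; use d(2) in \<open>force simp: abs_less_iff\<close>)+
      then obtain r l where "\<forall>x\<in>{t<..<t+d}. g x = r" "\<forall>x\<in>{t-d<..<t}. g x = l"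
        unfolding constant_on_def by blast
      then show ?thesis using d(1) True by (intro exI[of _ r] exI[of _ l] exI[of _ d]) auto
    next
      case False
      have "x \<notin> S" if "x \<in> {t-d<..<t+d}" for x
        using d(2)[of x] False that by (cases "x = t") (auto simp: abs_less_iff)
      then have "g constant_on {t-d<..<t+d}" by (intro g) blast
      then obtain c where "\<forall>x\<in>{t-d<..<t+d}. g x = c" unfolding constant_on_def by blast
      then show ?thesis using d(1) by (intro exI[of _ c] exI[of _ d]) auto
    qed
  qed
  then obtain h l D where D: "\<And>t. D t > 0"
    and hr: "\<And>t x. t < x \<Longrightarrow> x < t + D t \<Longrightarrow> g x = h t"
    and hl: "\<And>t x. t - D t < x \<Longrightarrow> x < t \<Longrightarrow> g x = l t"
    and reg: "\<And>t. t \<notin> S \<Longrightarrow> h t = g t" "\<And>t. t \<notin> S \<Longrightarrow> l t = g t"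
    by metis
  have good: "AE x in lebesgue. u x = g x \<and> u x \<in> {p, - p} \<and> u (x + 1) = u x \<and> u (x + 1) = g (x + 1)"
    using ug wells periodic AE_lebesgue_shift[OF ug, of 1] by eventually_elim simp
  have sample: "\<exists>x. a < x \<and> x < b \<and> u x = g x \<and> g x \<in> {p, - p} \<and> g (x + 1) = g x" if "a < b" for a b
    using AE_lebesgue_ex[OF good that] by force
  have h_val: "h t \<in> {p, - p}" for t
    using sample[of t "t + D t"] D[of t] hr[of t] by auto
  have l_val: "l t \<in> {p, - p}" for t
    using sample[of "t - D t" t] D[of t] hl[of t] by auto
  have h_per: "h (t + 1) = h t" for t
  proof -
    obtain x where "t < x" "x < t + min (D t) (D (t + 1))" "g (x + 1) = g x"
      using sample[of t "t + min (D t) (D (t + 1))"] D[of t] D[of "t + 1"] by auto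
    then show ?thesis using hr[of t x] hr[of "t + 1" "x + 1"] by simp
  qed
  have l_per: "l (t + 1) = l t" for t
  proof -
    obtain x where "t - min (D t) (D (t + 1)) < x" "x < t" "g (x + 1) = g x"
      using sample[of "t - min (D t) (D (t + 1))" t] D[of t] D[of "t + 1"] by auto
    then show ?thesis using hl[of t x] hl[of "t + 1" "x + 1"] by simp
  qed
  have h_right: "h x = h t" if x: "t < x" "x < t + D t" for t x
  proof -
    obtain y where "x < y" "y < min (x + D x) (t + D t)"
      using dense[of x "min (x + D x) (t + D t)"] D[of x] x by auto
    then show ?thesis using hr[of x y] hr[of t y] that by simp
  qed
  have h_left: "h x = l t" if x: "t - D t < x" "x < t" for t x
  proof -
    obtain y where "x < y" "y < min (x + D x) t"
      using dense[of x "min (x + D x) t"] D[of x] x by auto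
    then show ?thesis using hr[of x y] hl[of t y] that by simp
  qed
  have lim_r: "ess_lim_right u t r \<longleftrightarrow> r = h t" for t r
  proof
    assume r: "ess_lim_right u t r"
    show "r = h t"
    proof (rule ccontr)
      assume ne: "r \<noteq> h t"
      then have "\<bar>h t - r\<bar> > 0" by simp
      then obtain d where d: "d > 0" "AE x in lebesgue. x \<in> {t<..<t + d} \<longrightarrow> \<bar>u x - r\<bar> < \<bar>h t - r\<bar>"
        using r unfolding ess_lim_right_def by blast
      have "AE x in lebesgue. u x = g x \<and> (x \<in> {t<..<t + d} \<longrightarrow> \<bar>u x - r\<bar> < \<bar>h t - r\<bar>)"
        using ug d(2) by eventually_elim simp
      from AE_lebesgue_ex[OF this, of t "t + min d (D t)"] show False
        using d(1) D[of t] hr[of t] by auto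
    qed
  next
    assume r: "r = h t"
    show "ess_lim_right u t r" unfolding ess_lim_right_def
    proof (intro allI impI exI[of _ "D t"] conjI D)
      fix e :: real assume "e > 0"
      then show "AE x in lebesgue. x \<in> {t<..<t + D t} \<longrightarrow> \<bar>u x - r\<bar> < e"
        using ug by (auto elim!: eventually_mono simp: r hr)
    qed
  qed
  have lim_l: "ess_lim_left u t r \<longleftrightarrow> r = l t" for t r
  proof
    assume r: "ess_lim_left u t r"
    show "r = l t"
    proof (rule ccontr)
      assume ne: "r \<noteq> l t"
      then have "\<bar>l t - r\<bar> > 0" by simp
      then obtain d where d: "d > 0" "AE x in lebesgue. x \<in> {t - d<..<t} \<longrightarrow> \<bar>u x - r\<bar> < \<bar>l t - r\<bar>"
        using r unfolding ess_lim_left_def by blast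
      have "AE x in lebesgue. u x = g x \<and> (x \<in> {t - d<..<t} \<longrightarrow> \<bar>u x - r\<bar> < \<bar>l t - r\<bar>)"
        using ug d(2) by eventually_elim simp
      from AE_lebesgue_ex[OF this, of "t - min d (D t)" t] show False
        using d(1) D[of t] hl[of t] by auto
    qed
  next
    assume r: "r = l t"
    show "ess_lim_left u t r" unfolding ess_lim_left_def
    proof (intro allI impI exI[of _ "D t"] conjI D)
      fix e :: real assume "e > 0"
      then show "AE x in lebesgue. x \<in> {t - D t<..<t} \<longrightarrow> \<bar>u x - r\<bar> < e"
        using ug by (auto elim!: eventually_mono simp: r hl)
    qed
  qed
  have J: "s \<in> jump_set u \<longleftrightarrow> l s \<noteq> h s" for s
    unfolding jump_set_def lim_l lim_r by simp
  show ?thesis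
  proof (rule that[of h])
    show "AE t in lebesgue. u t = h t"
      using ug AE_lebesgue_not_in_countable[OF countable_locally_finite[OF S]]
      by eventually_elim (simp add: reg)
    show "h a = h b" if ab: "a \<le> b" and no: "{a<..b} \<inter> jump_set u = {}" for a b
    proof (rule connected_local_const[of "{a..b}" a b h])
      show "\<forall>t\<in>{a..b}. eventually (\<lambda>x. h t = h x) (at t within {a..b})"
      proof
        fix t assume t: "t \<in> {a..b}"
        have "h t = h x" if x: "x \<in> {a..b}" "x \<noteq> t" "dist x t < D t" for x
        proof (cases "t < x")
          case True
          then show ?thesis using h_right[of t x] x(3) by (simp add: dist_real_def)
        next
          case False
          then have "t \<in> {a<..b}" using x t by auto
          then have "l t = h t" using no J by blast
          then show ?thesis using h_left[of t x] False x by (simp add: dist_real_def)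
        qed
        then show "eventually (\<lambda>x. h t = h x) (at t within {a..b})"
          unfolding eventually_at using D by blast
      qed
    qed (use ab in auto)
    show "\<exists>d>0. \<forall>t. s - d < t \<and> t < s \<longrightarrow> h t = - h s" if s: "s \<in> jump_set u" for s
    proof -
      have "l s = - h s" using s J[of s] h_val[of s] l_val[of s] by auto
      then show ?thesis using h_left[of s] D[of s] by (intro exI[of _ "D s"]) auto
    qed
    show "finite (jump_set u \<inter> {a..b})" for a b
      by (rule finite_subset[OF _ S[of a b]]) (use J reg in \<open>auto, metis\<close>)
    show "s + 1 \<in> jump_set u \<longleftrightarrow> s \<in> jump_set u" for s
      unfolding J by (simp add: h_per l_per)
  qed (use h_val h_per in auto)
qed

lemma periodic_shift_int:
  fixes J :: "real set"
  assumes "\<And>s. s + 1 \<in> J \<longleftrightarrow> s \<in> J"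
  shows "s + real_of_int j \<in> J \<longleftrightarrow> s \<in> J"
proof (induction j rule: int_induct[where k=0])
  case (step1 i)
  then show ?case using assms[of "s + real_of_int i"] by (simp add: algebra_simps)
next
  case (step2 i)
  then show ?case using assms[of "s + real_of_int (i - 1)"] by (simp add: algebra_simps)
qed simp

lemma periodic_separation:
  fixes J :: "real set"
  assumes per: "\<And>s. s + 1 \<in> J \<longleftrightarrow> s \<in> J" and fin: "\<And>a b. finite (J \<inter> {a..b})"
  obtains d where "0 < d" "\<And>s s'. s \<in> J \<Longrightarrow> s' \<in> J \<Longrightarrow> s < s' \<Longrightarrow> s + d \<le> s'"
proof -
  obtain d where d: "0 < d" "\<And>x y. x \<in> J \<inter> {0..2} \<Longrightarrow> y \<in> J \<inter> {0..2} \<Longrightarrow> x < y \<Longrightarrow> x + d \<le> y"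
    using finite_separation[OF fin[of 0 2]] by blast
  have "s + min d 1 \<le> s'" if s: "s \<in> J" "s' \<in> J" "s < s'" for s s'
  proof (rule ccontr)
    assume no: "\<not> ?thesis"
    define x y where "x = s - real_of_int \<lfloor>s\<rfloor>" and "y = s' - real_of_int \<lfloor>s\<rfloor>"
    have "x \<in> J" "y \<in> J"
      using periodic_shift_int[of J x "\<lfloor>s\<rfloor>", OF per] periodic_shift_int[of J y "\<lfloor>s\<rfloor>", OF per] s
      by (simp_all add: x_def y_def)
    moreover have "0 \<le> x" "x < 1" "x < y" "y < x + min d 1"
      using s(3) no floor_correct[of s] unfolding x_def y_def by linarith+
    moreover from this have "y < x + d" "y \<le> 2" by auto
    ultimately show False using d(2)[of x y] by simp
  qed
  then show ?thesis using that[of "min d 1"] d(1) by simp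
qed

section \<open>Recovery sequences\<close>

text \<open>
  The lattice function \<open>w\<close> samples \<open>h\<close>, except that within distance \<open>N\<close> of the cell of a jump
  \<open>s\<close> it is the profile \<open>\<phi>\<close>, multiplied by the sign \<open>\<sigma> s\<close> of \<open>h\<close> at the right of \<open>s\<close>. The condition on \<open>n\<close> keeps the
  windows around distinct jumps apart, also when they are enlarged by one index on both sides. At the enlarged ends sample and profile agree
  (\<open>w_near\<close>), so each bond is either a bond of \<open>\<phi>\<close> (\<open>b_near\<close>) or joins two equal
  well values and is free (\<open>b_far\<close>).
\<close>

lemma recovery_lattice_function:
  fixes h :: "real \<Rightarrow> real" and J :: "real set" and n N :: nat
  assumes \<alpha>: "0 \<le> \<alpha>" "\<alpha> < 4"
    and h_val: "\<And>t. h t \<in> {crease_angle \<alpha>, - crease_angle \<alpha>}" and h_per: "\<And>t. h (t + 1) = h t"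
    and h_const: "\<And>a b. a \<le> b \<Longrightarrow> {a<..b} \<inter> J = {} \<Longrightarrow> h a = h b"
    and h_jump: "\<And>s. s \<in> J \<Longrightarrow> \<exists>d>0. \<forall>t. s - d < t \<and> t < s \<longrightarrow> h t = - h s"
    and J_fin: "\<And>a b. finite (J \<inter> {a..b})" and J_per: "\<And>s. s + 1 \<in> J \<longleftrightarrow> s \<in> J"
    and \<delta>: "0 < \<delta>" "\<And>s s'. s \<in> J \<Longrightarrow> s' \<in> J \<Longrightarrow> s < s' \<Longrightarrow> s + \<delta> \<le> s'"
    and n: "2 * real N + 4 \<le> real n * \<delta>" and N: "1 \<le> N" and \<phi>: "\<phi> \<in> crease_profiles \<alpha> N"
  obtains w :: "int \<Rightarrow> real" where
    "\<And>i. w (i + int n) = w i" "\<And>i. w i \<in> {-pi/2..pi/2}"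
    "chain_energy \<alpha> w 0 (int n) \<le> real (card (J \<inter> {0..<1})) * profile_energy \<alpha> \<phi>"
    "\<And>i. (\<And>s. s \<in> J \<Longrightarrow> int N < \<bar>i - \<lfloor>real n * s\<rfloor>\<bar>) \<Longrightarrow> w i = h (real_of_int i / real n)"
proof -
  let ?p = "crease_angle \<alpha>"
  have p: "0 < ?p" "?p \<le> pi / 2" by (rule crease_angle_range[OF \<alpha>])+
  have \<alpha>': "\<alpha> \<le> 4" using \<alpha> by simp
  have n0: "0 < real n"
  proof (rule ccontr)
    assume "\<not> ?thesis"
    then show False using n by simp
  qed
  define c where "c s = \<lfloor>real n * s\<rfloor>" for s
  define \<sigma> where "\<sigma> s = h s / ?p" for s
  have \<sigma>: "\<sigma> s = 1 \<or> \<sigma> s = - 1" for s using h_val[of s] p by (auto simp: \<sigma>_def)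
  have c_le: "real_of_int (c s) \<le> real n * s" and c_gt: "real n * s < real_of_int (c s) + 1" for s
    using floor_correct[of "real n * s"] by (auto simp: c_def)
  have c_shift: "c (s + real_of_int j) = c s + int n * j" for s j
  proof -
    have "real n * (s + real_of_int j) = real n * s + real_of_int (int n * j)" by (simp add: algebra_simps)
    then show ?thesis unfolding c_def by (simp only: floor_add_int)
  qed
  have sep: "c s + 2 * int N + 3 \<le> c s'" if "s \<in> J" "s' \<in> J" "s < s'" for s s'
  proof -
    have "real n * s + real n * \<delta> \<le> real n * s'"
      using mult_left_mono[OF \<delta>(2)[OF that], of "real n"] by (simp add: algebra_simps)
    then have "real_of_int (c s + 2 * int N + 3) < real_of_int (c s' + 1)"
      using n c_le[of s] c_gt[of s'] by simp
    then show ?thesis by linarith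
  qed
  have uniq: "s = s'" if "s \<in> J" "s' \<in> J" "\<bar>i - c s\<bar> \<le> int N + 1" "\<bar>i - c s'\<bar> \<le> int N + 1" for s s' i
    using sep[of s s'] sep[of s' s] that by (cases s s' rule: linorder_cases) auto
  have h_after: "h t = h s" if "s \<in> J" "s \<le> t" "t < s + \<delta>" for s t
  proof -
    have "{s<..t} \<inter> J = {}" using \<delta>(2)[OF that(1)] that(3) by fastforce
    then show ?thesis using h_const[of s t] that(2) by simp
  qed
  have h_before: "h t = - h s" if s: "s \<in> J" "s - \<delta> < t" "t < s" for s t
  proof -
    obtain d where d: "d > 0" "\<And>t. s - d < t \<Longrightarrow> t < s \<Longrightarrow> h t = - h s" using h_jump[OF s(1)] by blast
    obtain t' where t': "max t (s - d) < t'" "t' < s" using dense[of "max t (s - d)" s] d(1) s(3) by auto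
    have "{t<..t'} \<inter> J = {}" using \<delta>(2)[OF _ s(1)] s(2) t'(2) by fastforce
    then have "h t = h t'" using h_const[of t t'] t'(1) by simp
    then show ?thesis using d(2)[of t'] t' by simp
  qed
  define w where "w i = (if \<exists>s\<in>J. \<bar>i - c s\<bar> \<le> int N
      then (let s = (SOME s. s \<in> J \<and> \<bar>i - c s\<bar> \<le> int N) in \<sigma> s * \<phi> (i - c s))
      else h (real_of_int i / real n))" for i
  have w_far: "w i = h (real_of_int i / real n)" if "\<And>s. s \<in> J \<Longrightarrow> int N < \<bar>i - c s\<bar>" for i
  proof -
    have "\<not> (\<exists>s\<in>J. \<bar>i - c s\<bar> \<le> int N)" using that by (meson linorder_not_less)
    then show ?thesis by (simp add: w_def)
  qed
  have w_core: "w i = \<sigma> s * \<phi> (i - c s)" if s: "s \<in> J" "\<bar>i - c s\<bar> \<le> int N" for s i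
  proof -
    have "(SOME s. s \<in> J \<and> \<bar>i - c s\<bar> \<le> int N) = s"
    proof (rule some_equality)
      show "s' = s" if "s' \<in> J \<and> \<bar>i - c s'\<bar> \<le> int N" for s'
        using uniq[of s' s i] that s by simp
    qed (use s in simp)
    then show ?thesis using s unfolding w_def by (auto simp: Let_def)
  qed
  have w_near: "w i = \<sigma> s * \<phi> (i - c s)" if s: "s \<in> J" "\<bar>i - c s\<bar> \<le> int N + 1" for s i
  proof (cases "\<bar>i - c s\<bar> \<le> int N")
    case False
    have "int N < \<bar>i - c s'\<bar>" if s': "s' \<in> J" for s'
    proof (cases "s' = s")
      case True
      then show ?thesis using False by simp
    next
      case ne: False
      then have "\<not> \<bar>i - c s'\<bar> \<le> int N + 1" using uniq[OF s' s(1), of i] s(2) by blast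
      then show ?thesis by linarith
    qed
    then have wi: "w i = h (real_of_int i / real n)" by (rule w_far)
    have prof: "\<phi> j = crease_sign j * ?p" if "int N \<le> \<bar>j\<bar>" for j
      using \<phi> that by (simp add: crease_profiles_def)
    consider "i = c s + int N + 1" | "i = c s - int N - 1" using False s(2) by linarith
    then show ?thesis
    proof cases
      case 1
      have "real n * s < real_of_int i" using 1 c_gt[of s] by simp
      then have "s \<le> real_of_int i / real n" using n0 by (simp add: field_simps)
      moreover have "real_of_int i < real n * s + real n * \<delta>" using 1 c_le[of s] n by simp
      then have "real_of_int i / real n < s + \<delta>" using n0 by (simp add: field_simps)
      ultimately have "w i = h s" using wi h_after[OF s(1), of "real_of_int i / real n"] by simp
      then show ?thesis using p prof[of "i - c s"] 1 by (simp add: \<sigma>_def crease_sign_def)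
    next
      case 2
      have "real_of_int i < real n * s" using 2 c_le[of s] by simp
      then have "real_of_int i / real n < s" using n0 by (simp add: field_simps)
      moreover have "real n * s - real n * \<delta> < real_of_int i" using 2 c_gt[of s] n by simp
      then have "s - \<delta> < real_of_int i / real n" using n0 by (simp add: field_simps)
      ultimately have "w i = - h s" using wi h_before[OF s(1), of "real_of_int i / real n"] by simp
      then show ?thesis using p prof[of "i - c s"] 2 by (simp add: \<sigma>_def crease_sign_def)
    qed
  qed (use w_core s in simp)
  have w_per: "w (i + int n) = w i" for i
  proof (cases "\<exists>s\<in>J. \<bar>i - c s\<bar> \<le> int N")
    case True
    then obtain s where s: "s \<in> J" "\<bar>i - c s\<bar> \<le> int N" by blast
    have c1: "c (s + 1) = c s + int n" using c_shift[of s 1] by simp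
    have "w (i + int n) = \<sigma> (s + 1) * \<phi> (i + int n - c (s + 1))"
      by (rule w_core) (use s J_per c1 in auto)
    then show ?thesis using w_core[OF s] c1 h_per[of s] by (simp add: \<sigma>_def)
  next
    case False
    have "int N < \<bar>i + int n - c s\<bar>" if "s \<in> J" for s
    proof -
      have "s - 1 \<in> J" using J_per[of "s - 1"] that by simp
      moreover have "c (s - 1) = c s - int n" using c_shift[of s "-1"] by simp
      ultimately show ?thesis using False by (metis add_diff_eq diff_diff_eq2 not_le diff_add_eq)
    qed
    then have "w (i + int n) = h (real_of_int (i + int n) / real n)" by (rule w_far)
    also have "real_of_int (i + int n) / real n = real_of_int i / real n + 1"
      using n0 by (simp add: add_divide_distrib)
    finally show ?thesis using h_per w_far[of i] False by (simp add: not_le)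
  qed
  have w_range: "w i \<in> {-pi/2..pi/2}" for i
  proof (cases "\<exists>s\<in>J. \<bar>i - c s\<bar> \<le> int N")
    case True
    then obtain s where "s \<in> J" "\<bar>i - c s\<bar> \<le> int N" by blast
    then have "w i = \<sigma> s * \<phi> (i - c s)" by (rule w_core)
    moreover have "\<phi> (i - c s) \<in> {-pi/2..pi/2}" using \<phi> by (simp add: crease_profiles_def)
    ultimately show ?thesis using \<sigma>[of s] by auto
  next
    case False
    then have "w i = h (real_of_int i / real n)" using w_far[of i] by (simp add: not_le)
    then show ?thesis using h_val[of "real_of_int i / real n"] p by auto
  qed
  let ?b = "\<lambda>i. bond_energy \<alpha> (w i) (w (i + 1))"
  let ?q = "\<lambda>k. bond_energy \<alpha> (\<phi> k) (\<phi> (k + 1))"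
  have b_near: "?b i = ?q (i - c s)" if s: "s \<in> J" "- int N - 1 \<le> i - c s" "i - c s \<le> int N" for s i
  proof -
    have "w i = \<sigma> s * \<phi> (i - c s)" "w (i + 1) = \<sigma> s * \<phi> (i + 1 - c s)"
      by (rule w_near; use s in auto)+
    moreover have "i + 1 - c s = i - c s + 1" by simp
    ultimately show ?thesis using \<sigma>[of s] bond_energy_uminus by auto
  qed
  have b_far: "?b i = 0" if far: "\<And>s. s \<in> J \<Longrightarrow> \<not> (- int N - 1 \<le> i - c s \<and> i - c s \<le> int N)" for i
  proof -
    have w1: "w i = h (real_of_int i / real n)"
      by (rule w_far) (use far in force)
    have w2: "w (i + 1) = h (real_of_int (i + 1) / real n)"
      by (rule w_far) (use far in force)
    have "{real_of_int i / real n<..real_of_int (i + 1) / real n} \<inter> J = {}"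
    proof (rule ccontr)
      assume "\<not> ?thesis"
      then obtain s where s: "s \<in> J" "real_of_int i / real n < s" "s \<le> real_of_int (i + 1) / real n" by auto
      have "real_of_int i < real n * s" "real n * s \<le> real_of_int (i + 1)"
        using s n0 by (auto simp: field_simps)
      then have "i \<le> c s" "c s \<le> i + 1" using c_le[of s] c_gt[of s] by linarith+
      then show False using far[OF s(1)] N by auto
    qed
    then have "w i = w (i + 1)"
      unfolding w1 w2 using n0 by (intro h_const) (auto simp: divide_right_mono)
    then show ?thesis
      using bond_energy_crease_angle[OF \<alpha>(1) \<alpha>', of "w i"] h_val[of "real_of_int i / real n"] w1 by auto
  qed
  define P where "P = J \<inter> {0..<1}"
  have finP: "finite P" by (rule finite_subset[OF _ J_fin[of 0 1]]) (auto simp: P_def)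
  define A where "A = {i \<in> {0..<int n}. ?b i \<noteq> 0}"
  have finA: "finite A" unfolding A_def by (rule finite_subset[of _ "{0..<int n}"]) auto
  have "chain_energy \<alpha> w 0 (int n) = sum ?b A"
    unfolding chain_energy_def by (rule sum.mono_neutral_right) (auto simp: A_def)
  also have "\<dots> \<le> (\<Sum>(s, k)\<in>P \<times> {- int N - 1..int N}. ?q k)"
  \<comment> \<open>A bond of positive energy belongs to the window of a jump, taken in the unit interval after a shift by a whole number of periods.\<close>
  proof (rule sum_le_included[where i="\<lambda>(s, k). (c s + k) mod int n"])
    show "\<forall>i\<in>A. \<exists>y\<in>P \<times> {- int N - 1..int N}. (case y of (s, k) \<Rightarrow> (c s + k) mod int n) = i
        \<and> ?b i \<le> (case y of (s, k) \<Rightarrow> ?q k)"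
    proof
      fix i assume i: "i \<in> A"
      then obtain s where s: "s \<in> J" "- int N - 1 \<le> i - c s" "i - c s \<le> int N"
        using b_far[of i] by (auto simp: A_def)
      define s0 where "s0 = s + real_of_int (- \<lfloor>s\<rfloor>)"
      have "s0 \<in> J" unfolding s0_def using periodic_shift_int[of J s, OF J_per] s(1) by blast
      moreover have "0 \<le> s0" "s0 < 1" using floor_correct[of s] unfolding s0_def of_int_minus by linarith+
      ultimately have s0: "s0 \<in> P" by (simp add: P_def)
      have "c s0 + (i - c s) = i + int n * (- \<lfloor>s\<rfloor>)" unfolding s0_def c_shift by simp
      then have "(c s0 + (i - c s)) mod int n = i mod int n" by (simp only: mod_mult_self2)
      also have "\<dots> = i" using i by (simp add: A_def)
      finally show "\<exists>y\<in>P \<times> {- int N - 1..int N}. (case y of (s, k) \<Rightarrow> (c s + k) mod int n) = i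
          \<and> ?b i \<le> (case y of (s, k) \<Rightarrow> ?q k)"
        using s0 s b_near[OF s] by (intro bexI[of _ "(s0, i - c s)"]) auto
    qed
  qed (use finA finP \<alpha> bond_energy_nonneg_all_regimes in auto)
  also have "\<dots> = real (card P) * (\<Sum>k\<in>{- int N - 1..int N}. ?q k)"
    by (simp flip: sum.cartesian_product)
  also have "(\<Sum>k\<in>{- int N - 1..int N}. ?q k) = profile_energy \<alpha> \<phi>"
    by (rule profile_energy_eq_sum[OF \<alpha>(1) \<alpha>' \<phi>, symmetric])
  finally have "chain_energy \<alpha> w 0 (int n) \<le> real (card (J \<inter> {0..<1})) * profile_energy \<alpha> \<phi>"
    by (simp add: P_def)
  then show ?thesis using that[of w] w_per w_range w_far by (auto simp: c_def)
qed

lemma lattice_function_of_periodic: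
  assumes n: "0 < n" and per: "\<And>i. w (i + int n) = w i" and range: "\<And>i. w i \<in> {-pi/2..pi/2}"
  defines "v \<equiv> restrict (\<lambda>i. w (int i)) {0..n}"
  shows "v \<in> lattice_functions n" "periodize n v = w"
proof -
  show "v \<in> lattice_functions n"
    using range per[of 0] by (auto simp: v_def lattice_functions_def)
  show "periodize n v = w"
  proof
    fix i
    have "0 \<le> i mod int n" "i mod int n < int n" using n by simp_all
    then have "periodize n v i = w (i mod int n)" by (simp add: periodize_def v_def nat_le_iff)
    also have "w (i mod int n + int n * j) = w (i mod int n)" for j
    proof (induction j rule: int_induct[where k=0])
      case (step1 j)
      then show ?case using per[of "i mod int n + int n * j"] by (simp add: algebra_simps)
    next
      case (step2 j)
      then show ?case using per[of "i mod int n + int n * (j - 1)"] by (simp add: algebra_simps)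
    qed simp
    from this[of "i div int n"] have "w (i mod int n) = w i" by simp
    finally show "periodize n v i = w i" .
  qed
qed

lemma interp_L1_loc:
  assumes n: "0 < n" and v: "v \<in> lattice_functions n"
  shows "interp n v \<in> L1_loc"
proof -
  have eq: "interp n v = (\<lambda>t. periodize n v \<lfloor>real n * t\<rfloor>)" using interp_eq_periodize[OF n] by blast
  have "(\<lambda>t. \<lfloor>real n * t\<rfloor>) \<in> measurable borel (count_space UNIV)" by measurable
  then have "(\<lambda>t. periodize n v \<lfloor>real n * t\<rfloor>) \<in> borel_measurable borel"
    by (rule measurable_compose) simp
  then have meas: "interp n v \<in> borel_measurable lebesgue"
    unfolding eq by (simp add: measurable_completion)
  have bnd: "\<bar>interp n v t\<bar> \<le> pi / 2" for t
    using periodize_range[OF v n, of "\<lfloor>real n * t\<rfloor>"] unfolding eq atLeastAtMost_iff by linarith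
  have "set_integrable lebesgue {a..b} (interp n v)" for a b :: real
    unfolding set_integrable_def
  proof (rule Bochner_Integration.integrable_bound)
    show "integrable lebesgue (\<lambda>t. indicator {a..b} t * (pi / 2))"
      by (intro integrable_mult_left integrable_real_indicator) (auto simp: emeasure_lborel_Icc_eq)
    show "(\<lambda>t. indicat_real {a..b} t *\<^sub>R interp n v t) \<in> borel_measurable lebesgue"
      by (intro borel_measurable_scaleR borel_measurable_indicator meas) simp
  qed (use bnd in \<open>auto simp: indicator_def\<close>)
  then show ?thesis by (simp add: L1_loc_def)
qed

lemma tendsto_L1_loc_dominated:
  assumes us: "\<And>n. us n \<in> L1_loc" and u: "u \<in> L1_loc"
    and bound: "\<And>n t. \<bar>us n t - u t\<bar> \<le> K + \<bar>u t\<bar>" and K: "0 \<le> K"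
    and lim: "AE t in lebesgue. (\<lambda>n. us n t) \<longlonglongrightarrow> u t"
  shows "tendsto_L1_loc us u"
  unfolding tendsto_L1_loc_def
proof (intro allI)
  fix a b :: real
  have int: "set_integrable lebesgue {a..b} (us n)" "set_integrable lebesgue {a..b} u" for n
    using us[of n] u by (auto simp: L1_loc_def)
  have intd: "set_integrable lebesgue {a..b} (\<lambda>t. \<bar>us n t - u t\<bar>)" for n
    by (intro set_integrable_abs set_integral_diff int)
  have "set_integrable lebesgue {a..b} (\<lambda>t. K)"
    unfolding set_integrable_def
    by (simp, intro integrable_real_indicator disjI2) (auto simp: emeasure_lborel_Icc_eq)
  then have intK: "set_integrable lebesgue {a..b} (\<lambda>t. K + \<bar>u t\<bar>)"
    by (intro set_integral_add set_integrable_abs int)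
  have "(\<lambda>n. LINT t|lebesgue. indicator {a..b} t *\<^sub>R \<bar>us n t - u t\<bar>) \<longlonglongrightarrow> (LINT t|(lebesgue :: real measure). (0::real))"
  proof (rule integral_dominated_convergence[where w="\<lambda>t. indicator {a..b} t *\<^sub>R (K + \<bar>u t\<bar>)"])
    show "integrable lebesgue (\<lambda>t. indicator {a..b} t *\<^sub>R (K + \<bar>u t\<bar>))"
      using intK by (simp add: set_integrable_def)
    show "(\<lambda>t. indicator {a..b} t *\<^sub>R \<bar>us n t - u t\<bar>) \<in> borel_measurable lebesgue" for n
      using intd[of n] unfolding set_integrable_def by (rule borel_measurable_integrable)
    show "AE t in lebesgue. (\<lambda>n. indicator {a..b} t *\<^sub>R \<bar>us n t - u t\<bar>) \<longlonglongrightarrow> 0"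
      using lim
    proof eventually_elim
      case (elim t)
      have "(\<lambda>n. \<bar>us n t - u t\<bar>) \<longlonglongrightarrow> 0" using elim by (simp add: tendsto_rabs_zero_iff LIM_zero_iff)
      from tendsto_scaleR[OF tendsto_const this] show ?case by simp
    qed
    show "AE t in lebesgue. norm (indicator {a..b} t *\<^sub>R \<bar>us n t - u t\<bar>) \<le> indicator {a..b} t *\<^sub>R (K + \<bar>u t\<bar>)" for n
      using bound[of n] by (auto simp: indicator_def)
  qed simp
  then show "(\<lambda>n. LINT t:{a..b}|lebesgue. \<bar>us n t - u t\<bar>) \<longlonglongrightarrow> 0"
    by (simp add: set_lebesgue_integral_def)
qed

text \<open>
  The classes of profiles increase with \<open>N\<close>, so a near-optimal profile of any class
  eventually competes with the minimisers.
\<close>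

lemma minimal_profile_energy_tendsto:
  assumes \<alpha>: "0 \<le> \<alpha>" "\<alpha> \<le> 4" and N: "filterlim N at_top sequentially"
    and \<phi>: "\<And>n. \<phi> n \<in> crease_profiles \<alpha> (N n)"
    and min: "\<And>n \<psi>. \<psi> \<in> crease_profiles \<alpha> (N n) \<Longrightarrow> profile_energy \<alpha> (\<phi> n) \<le> profile_energy \<alpha> \<psi>"
  shows "(\<lambda>n. profile_energy \<alpha> (\<phi> n)) \<longlonglongrightarrow> crease_energy \<alpha>"
proof (rule order_tendstoI)
  fix c assume c: "c < crease_energy \<alpha>"
  have "eventually (\<lambda>n. 1 \<le> N n) sequentially" using N by (simp add: filterlim_at_top)
  then show "eventually (\<lambda>n. c < profile_energy \<alpha> (\<phi> n)) sequentially"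
    by eventually_elim (use crease_energy_le_profile[OF \<alpha> _ \<phi>] c in fastforce)
next
  fix c assume c: "crease_energy \<alpha> < c"
  have ne: "crease_profiles \<alpha> M \<noteq> {}" for M
    using profile_energy_attains_min[OF \<alpha>, of M] by blast
  obtain M where M: "1 \<le> M" "(INF \<theta>\<in>crease_profiles \<alpha> M. profile_energy \<alpha> \<theta>) < c"
    using cInf_lessD[OF _ c[unfolded crease_energy_def]] by auto
  obtain \<psi> where \<psi>: "\<psi> \<in> crease_profiles \<alpha> M" "profile_energy \<alpha> \<psi> < c"
    using cInf_lessD[OF _ M(2)] ne by auto
  have "eventually (\<lambda>n. M \<le> N n) sequentially" using N by (simp add: filterlim_at_top)
  then show "eventually (\<lambda>n. profile_energy \<alpha> (\<phi> n) < c) sequentially"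
  proof eventually_elim
    case (elim n)
    have "\<psi> \<in> crease_profiles \<alpha> (N n)" using \<psi>(1) elim by (auto simp: crease_profiles_def)
    then show ?case using min \<psi>(2) by fastforce
  qed
qed

text \<open>
  If the limit energy is infinite, the constant sequence is a recovery sequence. Otherwise the
  lattice functions built from minimal profiles are used: away from the jumps they eventually agree with \<open>h\<close> at
  each point, so dominated convergence gives convergence in \<open>L\<^sup>1\<^sub>l\<^sub>o\<^sub>c\<close>.
\<close>

lemma crease_recovery:
  assumes \<alpha>: "0 \<le> \<alpha>" "\<alpha> < 4" and u: "u \<in> L1_loc"
  shows "\<exists>us. (\<forall>n. us n \<in> L1_loc) \<and> tendsto_L1_loc us u
    \<and> limsup (\<lambda>n. E_n n \<alpha> (us n)) \<le> E_crease \<alpha> u"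
proof (cases "E_crease \<alpha> u = \<infinity>")
  case True
  have "tendsto_L1_loc (\<lambda>n. u) u" by (simp add: tendsto_L1_loc_def)
  then show ?thesis using u True by (intro exI[of _ "\<lambda>n. u"]) simp
next
  case False
  let ?p = "crease_angle \<alpha>"
  define J where "J = jump_set u"
  have fin: "u \<in> PC_loc" "AE t in lebesgue. u t \<in> {?p, - ?p}" "AE t in lebesgue. u (t + 1) = u t"
    and Eu: "E_crease \<alpha> u = ereal (crease_energy \<alpha> * real (card (J \<inter> {0..<1})))"
    using False by (auto simp: E_crease_def J_def split: if_splits)
  obtain h where h: "\<And>t. h t \<in> {?p, - ?p}" "\<And>t. h (t + 1) = h t" "AE t in lebesgue. u t = h t"
    "\<And>a b. a \<le> b \<Longrightarrow> {a<..b} \<inter> J = {} \<Longrightarrow> h a = h b"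
    "\<And>s. s \<in> J \<Longrightarrow> \<exists>d>0. \<forall>t. s - d < t \<and> t < s \<longrightarrow> h t = - h s"
    and J: "\<And>a b. finite (J \<inter> {a..b})" "\<And>s. s + 1 \<in> J \<longleftrightarrow> s \<in> J"
    using two_valued_step_representative[OF fin] unfolding J_def by blast
  obtain \<delta> where \<delta>: "0 < \<delta>" "\<And>s s'. s \<in> J \<Longrightarrow> s' \<in> J \<Longrightarrow> s < s' \<Longrightarrow> s + \<delta> \<le> s'"
    using periodic_separation[OF J(2,1)] by blast
  \<comment> \<open>Any choice with N tending to infinity and N/n tending to 0 would do.\<close>
  define N where "N n = nat \<lfloor>sqrt (real n)\<rfloor>" for n
  have \<alpha>': "\<alpha> \<le> 4" using \<alpha> by simp
  have N_le: "real (N n) \<le> sqrt (real n)" for n by (simp add: N_def)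
  have N_top: "filterlim N at_top sequentially"
    unfolding N_def
    by (intro filterlim_compose[OF filterlim_nat_sequentially] filterlim_compose[OF filterlim_floor_sequentially]
        filterlim_compose[OF sqrt_at_top] filterlim_real_sequentially)
  have N_small: "eventually (\<lambda>n. 2 * real (N n) + 4 \<le> real n * d) sequentially" if d: "0 < d" for d
  proof -
    have "filterlim (\<lambda>n. sqrt (real n)) at_top sequentially"
      by (intro filterlim_compose[OF sqrt_at_top] filterlim_real_sequentially)
    then have "eventually (\<lambda>n. 6 / d + 1 \<le> sqrt (real n)) sequentially"
      by (simp add: filterlim_at_top)
    then show ?thesis
    proof eventually_elim
      case (elim n)
      have "1 \<le> sqrt (real n)" using elim d divide_nonneg_pos[of 6 d] by linarith
      then have "2 * real (N n) + 4 \<le> 6 * sqrt (real n)" using N_le[of n] by linarith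
      also have "6 \<le> sqrt (real n) * d" using elim d by (simp add: field_simps)
      then have "6 * sqrt (real n) \<le> (sqrt (real n) * d) * sqrt (real n)" by (intro mult_right_mono) auto
      also have "\<dots> = real n * d" by simp
      finally show ?case .
    qed
  qed
  have "\<exists>\<phi>. \<phi> \<in> crease_profiles \<alpha> (N n) \<and> (\<forall>\<psi>\<in>crease_profiles \<alpha> (N n). profile_energy \<alpha> \<phi> \<le> profile_energy \<alpha> \<psi>)" for n
    using profile_energy_attains_min[OF \<alpha>(1) \<alpha>', of "N n"] by blast
  then obtain \<phi> where \<phi>: "\<And>n. \<phi> n \<in> crease_profiles \<alpha> (N n)"
    "\<And>n \<psi>. \<psi> \<in> crease_profiles \<alpha> (N n) \<Longrightarrow> profile_energy \<alpha> (\<phi> n) \<le> profile_energy \<alpha> \<psi>"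
    by metis
  define good where "good n \<longleftrightarrow> 0 < n \<and> 1 \<le> N n \<and> 2 * real (N n) + 4 \<le> real n * \<delta>" for n
  have good: "eventually good sequentially"
  proof -
    have "eventually (\<lambda>n. 1 \<le> N n) sequentially" using N_top by (simp add: filterlim_at_top)
    then show ?thesis using N_small[OF \<delta>(1)] eventually_gt_at_top[of 0]
      by eventually_elim (simp add: good_def)
  qed
  have "\<exists>w. (\<forall>i. w (i + int n) = w i) \<and> (\<forall>i. w i \<in> {-pi/2..pi/2}) \<and>
      chain_energy \<alpha> w 0 (int n) \<le> real (card (J \<inter> {0..<1})) * profile_energy \<alpha> (\<phi> n) \<and>
      (\<forall>i. (\<forall>s\<in>J. int (N n) < \<bar>i - \<lfloor>real n * s\<rfloor>\<bar>) \<longrightarrow> w i = h (real_of_int i / real n))"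
    if gn: "good n" for n
  proof -
    have "2 * real (N n) + 4 \<le> real n * \<delta>" "1 \<le> N n" using gn by (auto simp: good_def)
    from recovery_lattice_function[of \<alpha> h J \<delta> "N n" n "\<phi> n", OF \<alpha> h(1,2,4,5) J \<delta> this \<phi>(1)]
    obtain w where "\<And>i. w (i + int n) = w i" "\<And>i. w i \<in> {-pi/2..pi/2}"
      "chain_energy \<alpha> w 0 (int n) \<le> real (card (J \<inter> {0..<1})) * profile_energy \<alpha> (\<phi> n)"
      "\<And>i. (\<And>s. s \<in> J \<Longrightarrow> int (N n) < \<bar>i - \<lfloor>real n * s\<rfloor>\<bar>) \<Longrightarrow> w i = h (real_of_int i / real n)"
      by blast
    then show ?thesis by (intro exI[of _ w] conjI allI impI) auto
  qed
  then obtain w :: "nat \<Rightarrow> int \<Rightarrow> real" where w: "\<And>n i. good n \<Longrightarrow> w n (i + int n) = w n i"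
    "\<And>n i. good n \<Longrightarrow> w n i \<in> {-pi/2..pi/2}"
    "\<And>n. good n \<Longrightarrow> chain_energy \<alpha> (w n) 0 (int n) \<le> real (card (J \<inter> {0..<1})) * profile_energy \<alpha> (\<phi> n)"
    "\<And>n i. good n \<Longrightarrow> (\<And>s. s \<in> J \<Longrightarrow> int (N n) < \<bar>i - \<lfloor>real n * s\<rfloor>\<bar>) \<Longrightarrow> w n i = h (real_of_int i / real n)"
    by metis
  define v where "v n = restrict (\<lambda>i. w n (int i)) {0..n}" for n
  have v: "v n \<in> lattice_functions n" "periodize n (v n) = w n" if "good n" for n
    unfolding v_def using lattice_function_of_periodic[of n "w n"] w(1,2)[OF that] that
    by (auto simp: good_def)
  \<comment> \<open>The finitely many n for which the windows might overlap do not affect the limit.\<close>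
  define us where "us n = (if good n then interp n (v n) else u)" for n
  have us_eq: "us n t = w n \<lfloor>real n * t\<rfloor>" if "good n" for n t
    using interp_eq_periodize[of n "v n" t] v(2)[OF that] that by (simp add: us_def good_def)
  have us_L1: "us n \<in> L1_loc" for n
    using u interp_L1_loc[of n "v n"] v(1)[of n] by (auto simp: us_def good_def)
  have bound: "\<bar>us n t - u t\<bar> \<le> pi / 2 + \<bar>u t\<bar>" for n t
  proof (cases "good n")
    case True
    have "\<bar>us n t\<bar> \<le> pi / 2" using w(2)[OF True, of "\<lfloor>real n * t\<rfloor>"] us_eq[OF True] by (auto simp: abs_le_iff)
    then show ?thesis by linarith
  qed (use pi_gt_zero in \<open>simp add: us_def\<close>)
  have away: "eventually (\<lambda>n. us n t = h t) sequentially" if t: "t \<notin> J" for t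
  proof -
    obtain d0 where d0: "d0 > 0" "\<And>s. s \<in> J \<inter> {t - 1..t + 1} \<Longrightarrow> s \<noteq> t \<Longrightarrow> d0 \<le> dist t s"
      using finite_set_avoid[OF J(1)[of "t - 1" "t + 1"], of t] by blast
    define d where "d = min d0 1"
    have d: "0 < d" using d0(1) by (simp add: d_def)
    have dist: "d \<le> \<bar>t - s\<bar>" if s: "s \<in> J" for s
    proof (cases "s \<in> {t - 1..t + 1}")
      case True
      moreover have "s \<noteq> t" using s t by blast
      ultimately have "d0 \<le> \<bar>t - s\<bar>" using d0(2)[of s] s by (simp add: dist_real_def)
      then show ?thesis by (simp add: d_def)
    next
      case False
      then have "1 \<le> \<bar>t - s\<bar>" by auto
      then show ?thesis by (simp add: d_def)
    qed
    show ?thesis using good N_small[OF d]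
    proof eventually_elim
      case (elim n)
      have n: "0 < real n" using elim(1) by (simp add: good_def)
      define i where "i = \<lfloor>real n * t\<rfloor>"
      have i: "real_of_int i \<le> real n * t" "real n * t < real_of_int i + 1"
        using floor_correct[of "real n * t"] by (auto simp: i_def)
      have far: "int (N n) < \<bar>i - \<lfloor>real n * s\<rfloor>\<bar>" if s: "s \<in> J" for s
      proof -
        have "real n * d \<le> real n * \<bar>t - s\<bar>" using dist[OF s] by (intro mult_left_mono) auto
        also have "\<dots> = \<bar>real n * t - real n * s\<bar>" using n by (simp add: abs_mult flip: right_diff_distrib)
        finally have "2 * real (N n) + 4 \<le> \<bar>real n * t - real n * s\<bar>" using elim(2) by linarith
        then have "real (N n) < \<bar>real_of_int i - real_of_int \<lfloor>real n * s\<rfloor>\<bar>"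
          using i floor_correct[of "real n * s"] by linarith
        then show ?thesis by linarith
      qed
      have "us n t = h (real_of_int i / real n)"
        using us_eq[OF elim(1)] w(4)[OF elim(1) far] by (simp add: i_def)
      also have "\<dots> = h t"
      proof (rule h(4))
        show "real_of_int i / real n \<le> t" using i(1) n by (simp add: field_simps)
        have "1 < real n * d" using elim(2) by simp
        then have "1 / real n < d" using n by (simp add: field_simps)
        moreover have "t < (real_of_int i + 1) / real n" using i(2) n by (simp add: field_simps)
        then have "t - 1 / real n < real_of_int i / real n" by (simp add: add_divide_distrib)
        ultimately have "t - d < real_of_int i / real n" by linarith
        then show "{real_of_int i / real n<..t} \<inter> J = {}" using dist by fastforce
      qed
      finally show ?case .
    qed
  qed
  have conv: "tendsto_L1_loc us u"
  proof (rule tendsto_L1_loc_dominated[OF us_L1 u bound])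
    show "AE t in lebesgue. (\<lambda>n. us n t) \<longlonglongrightarrow> u t"
      using h(3) AE_lebesgue_not_in_countable[OF countable_locally_finite[OF J(1)]]
    proof eventually_elim
      case (elim t)
      then show ?case using away[OF elim(2)] by (simp add: tendsto_eventually)
    qed
  qed simp
  let ?E = "\<lambda>n. ereal (real (card (J \<inter> {0..<1})) * profile_energy \<alpha> (\<phi> n))"
  have "eventually (\<lambda>n. E_n n \<alpha> (us n) \<le> ?E n) sequentially"
    using good
  proof eventually_elim
    case (elim n)
    have "E_n n \<alpha> (us n) = ereal (chain_energy \<alpha> (periodize n (v n)) 0 (int n))"
      by (rule E_n_eq_chain_energy) (use elim v(1) in \<open>auto simp: good_def us_def\<close>)
    then show ?case using w(3)[OF elim] v(2)[OF elim] by simp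
  qed
  then have "limsup (\<lambda>n. E_n n \<alpha> (us n)) \<le> limsup ?E" by (rule Limsup_mono)
  also have "?E \<longlonglongrightarrow> ereal (real (card (J \<inter> {0..<1})) * crease_energy \<alpha>)"
    by (intro tendsto_intros minimal_profile_energy_tendsto[OF \<alpha>(1) \<alpha>' N_top \<phi>])
  then have "limsup ?E = ereal (real (card (J \<inter> {0..<1})) * crease_energy \<alpha>)"
    by (intro lim_imp_Limsup) auto
  finally have "limsup (\<lambda>n. E_n n \<alpha> (us n)) \<le> E_crease \<alpha> u" by (simp add: Eu mult.commute)
  then show ?thesis using us_L1 conv by blast
qed

lemma flat_recovery:
  assumes \<alpha>: "4 \<le> \<alpha>" and u: "u \<in> L1_loc"
  shows "\<exists>us. (\<forall>n. us n \<in> L1_loc) \<and> tendsto_L1_loc us u \<and> limsup (\<lambda>n. E_n n \<alpha> (us n)) \<le> E_flat u"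
proof -
  have conv: "tendsto_L1_loc (\<lambda>n. u) u" by (simp add: tendsto_L1_loc_def)
  show ?thesis
  proof (cases "AE t in lebesgue. u t = 0")
    case False
    then show ?thesis using u conv by (intro exI[of _ "\<lambda>n. u"]) (simp add: E_flat_def)
  next
    case True
    have zero: "E_n n \<alpha> u = 0" if n: "0 < n" for n
    proof -
      define v where "v = restrict (\<lambda>i. (\<lambda>_. 0) (int i) :: real) {0..n}"
      have v: "v \<in> lattice_functions n" "periodize n v = (\<lambda>_. 0)"
        unfolding v_def by (rule lattice_function_of_periodic; use n in simp)+
      have "AE t in lebesgue. u t = interp n v t"
        using True by (simp add: interp_eq_periodize[OF n] v(2))
      from E_n_eq_chain_energy[OF n v(1) this, of \<alpha>] show ?thesis
        by (simp add: v(2) chain_energy_def bond_energy_steep_eq[OF \<alpha>] zero_ereal_def)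
    qed
    have "eventually (\<lambda>n. E_n n \<alpha> u \<le> 0) sequentially"
      using eventually_gt_at_top[of 0] by eventually_elim (simp add: zero)
    then have "limsup (\<lambda>n. E_n n \<alpha> u) \<le> 0" by (rule Limsup_bounded)
    then show ?thesis using u conv True by (intro exI[of _ "\<lambda>n. u"]) (simp add: E_flat_def)
  qed
qed

theorem theorem3p5:
  fixes \<alpha> :: real
  shows "(0 \<le> \<alpha> \<and> \<alpha> < 4 \<longrightarrow>
            gamma_converges L1_loc tendsto_L1_loc (\<lambda>n. E_n n \<alpha>) (E_crease \<alpha>)) \<and>
         (4 \<le> \<alpha> \<longrightarrow>
            gamma_converges L1_loc tendsto_L1_loc (\<lambda>n. E_n n \<alpha>) E_flat)"
proof (intro conjI impI)
  assume "0 \<le> \<alpha> \<and> \<alpha> < 4"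
  then have \<alpha>: "0 \<le> \<alpha>" "\<alpha> < 4" by auto
  show "gamma_converges L1_loc tendsto_L1_loc (\<lambda>n. E_n n \<alpha>) (E_crease \<alpha>)"
    unfolding gamma_converges_def
  proof (intro ballI conjI allI impI)
    fix u us assume u: "u \<in> L1_loc" and us: "(\<forall>n. us n \<in> L1_loc) \<and> tendsto_L1_loc us u"
    show "E_crease \<alpha> u \<le> liminf (\<lambda>n. E_n n \<alpha> (us n))"
    proof (rule liminf_inequality[where F="E_crease \<alpha>"])
      show "E_crease \<alpha> u \<le> ereal L"
        if "\<And>k i. w k (i + int (m k)) = w k i" "\<And>k i. w k i \<in> {-pi/2..pi/2}"
          "\<And>k. chain_energy \<alpha> (w k) 0 (int (m k)) \<le> L" "filterlim m at_top sequentially"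
          "AE t in lebesgue. (\<lambda>k. w k \<lfloor>real (m k) * t\<rfloor>) \<longlonglongrightarrow> u t"
        for w :: "nat \<Rightarrow> int \<Rightarrow> real" and m :: "nat \<Rightarrow> nat" and L
        by (rule crease_lower_bound[OF \<alpha> that])
    qed (use u us in blast)+
  qed (rule crease_recovery[OF \<alpha>])
next
  assume \<alpha>: "4 \<le> \<alpha>"
  show "gamma_converges L1_loc tendsto_L1_loc (\<lambda>n. E_n n \<alpha>) E_flat"
    unfolding gamma_converges_def
  proof (intro ballI conjI allI impI)
    fix u us assume u: "u \<in> L1_loc" and us: "(\<forall>n. us n \<in> L1_loc) \<and> tendsto_L1_loc us u"
    show "E_flat u \<le> liminf (\<lambda>n. E_n n \<alpha> (us n))"
    proof (rule liminf_inequality[where F=E_flat])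
      show "E_flat u \<le> ereal L"
        if "\<And>k i. w k (i + int (m k)) = w k i" "\<And>k i. w k i \<in> {-pi/2..pi/2}"
          "\<And>k. chain_energy \<alpha> (w k) 0 (int (m k)) \<le> L" "filterlim m at_top sequentially"
          "AE t in lebesgue. (\<lambda>k. w k \<lfloor>real (m k) * t\<rfloor>) \<longlonglongrightarrow> u t"
        for w :: "nat \<Rightarrow> int \<Rightarrow> real" and m :: "nat \<Rightarrow> nat" and L
        by (rule flat_lower_bound[OF \<alpha> that])
    qed (use u us in blast)+
  qed (rule flat_recovery[OF \<alpha>])
qed

end
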